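(* Let $\mathbf{A}$ be a finite algebra. Then $\mathbf{A}$ is solvable if and only if for every neighborhood $U$ of $\mathbf{A}$ and every idempotent polynomial $p$ of the induced algebra $\mathbf{A}|_U$, the directed graph $\mathrm{Tr}(p)$ is strongly connected.
   Context: Solvability is in the sense of the (term condition) commutator of tame congruence theory: the derived series $1_{\mathbf A}\ge[1,1]\ge[[1,1],[1,1]]\ge\cdots$ reaches $0_{\mathbf A}$. A polynomial $p$ is idempotent if $p(x,\dots,x)=x$ for all $x$. A neighborhood of $\mathbf{A}$ is a set $U=e(A)$ with $e$ a unary polynomial of $\mathbf{A}$ satisfying $e(e(x))=e(x)$; the induced algebra $\mathbf{A}|_U$ has universe $U$ and as operations the restrictions to $U$ of the polynomials of $\mathbf{A}$ under which $U$ is closed. For an idempotent polynomial $p$ of an algebra with universe $B$, the translation-digraph $\mathrm{Tr}(p)$ has vertex set $B$ and directed edges $(c,\,p(c,\dots,c,d,c,\dots,c))$ for all $c,d\in B$, where $d$ occurs in exactly one (arbitrary) argument position. *)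

theory Defs
  imports Main
begin

text \<open>An algebra is given by a universe A and a set F of basic operations,
each a pair (arity, function on lists). An n-ary operation is evaluated on
lists of length n.\<close>

type_synonym 'a ops = "(nat \<times> ('a list \<Rightarrow> 'a)) set"

definition is_algebra :: "'a set \<Rightarrow> 'a ops \<Rightarrow> bool" where
  "is_algebra A F \<longleftrightarrow>
     (\<forall>(k, f) \<in> F. \<forall>xs. length xs = k \<and> set xs \<subseteq> A \<longrightarrow> f xs \<in> A)"

text \<open>The clone generated by F together with constants from C.
  C = {} gives the term operations, C = A gives the polynomial operations.\<close>
inductive clo :: "'a set \<Rightarrow> 'a ops \<Rightarrow> nat \<Rightarrow> ('a list \<Rightarrow> 'a) \<Rightarrow> bool"
  for C :: "'a set" and F :: "'a ops" where
  proj: "i < n \<Longrightarrow> clo C F n (\<lambda>xs. xs ! i)"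
| const: "c \<in> C \<Longrightarrow> clo C F n (\<lambda>xs. c)"
| comp: "(k, g) \<in> F \<Longrightarrow> length hs = k \<Longrightarrow> (\<forall>h \<in> set hs. clo C F n h)
          \<Longrightarrow> clo C F n (\<lambda>xs. g (map (\<lambda>h. h xs) hs))"

abbreviation term_op :: "'a ops \<Rightarrow> nat \<Rightarrow> ('a list \<Rightarrow> 'a) \<Rightarrow> bool" where
  "term_op F n t \<equiv> clo {} F n t"

abbreviation poly_op :: "'a set \<Rightarrow> 'a ops \<Rightarrow> nat \<Rightarrow> ('a list \<Rightarrow> 'a) \<Rightarrow> bool" where
  "poly_op A F n p \<equiv> clo A F n p"

definition congruence :: "'a set \<Rightarrow> 'a ops \<Rightarrow> 'a rel \<Rightarrow> bool" where
  "congruence A F \<theta> \<longleftrightarrow> equiv A \<theta> \<and>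
     (\<forall>(k, f) \<in> F. \<forall>xs ys. length xs = k \<and> length ys = k \<and>
        list_all2 (\<lambda>x y. (x, y) \<in> \<theta>) xs ys \<longrightarrow> (f xs, f ys) \<in> \<theta>)"

text \<open>Term condition C(alpha, beta; delta).\<close>
definition centralizes :: "'a ops \<Rightarrow> 'a rel \<Rightarrow> 'a rel \<Rightarrow> 'a rel \<Rightarrow> bool" where
  "centralizes F \<alpha> \<beta> \<delta> \<longleftrightarrow>
     (\<forall>m n t a b c d. term_op F (m + n) t \<and>
        length a = m \<and> length b = m \<and> list_all2 (\<lambda>x y. (x, y) \<in> \<alpha>) a b \<and>
        length c = n \<and> length d = n \<and> list_all2 (\<lambda>x y. (x, y) \<in> \<beta>) c d \<and>
        (t (a @ c), t (a @ d)) \<in> \<delta> \<longrightarrow> (t (b @ c), t (b @ d)) \<in> \<delta>)"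

text \<open>The term condition commutator: the least congruence delta with C(alpha,beta;delta).\<close>
definition commutator :: "'a set \<Rightarrow> 'a ops \<Rightarrow> 'a rel \<Rightarrow> 'a rel \<Rightarrow> 'a rel" where
  "commutator A F \<alpha> \<beta> = \<Inter> {\<delta>. congruence A F \<delta> \<and> centralizes F \<alpha> \<beta> \<delta>}"

primrec derived :: "'a set \<Rightarrow> 'a ops \<Rightarrow> nat \<Rightarrow> 'a rel" where
  "derived A F 0 = A \<times> A"
| "derived A F (Suc k) = commutator A F (derived A F k) (derived A F k)"

definition solvable :: "'a set \<Rightarrow> 'a ops \<Rightarrow> bool" where
  "solvable A F \<longleftrightarrow> (\<exists>k. derived A F k = Id_on A)"

definition neighborhood :: "'a set \<Rightarrow> 'a ops \<Rightarrow> 'a set \<Rightarrow> bool" where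
  "neighborhood A F U \<longleftrightarrow> (\<exists>e. poly_op A F 1 e \<and> (\<forall>x \<in> A. e [e [x]] = e [x])
       \<and> U = (\<lambda>x. e [x]) ` A)"

text \<open>Operations of the induced algebra A|_U: (restrictions of) the polynomials
  of A under which U is closed.\<close>
definition induced_ops :: "'a set \<Rightarrow> 'a ops \<Rightarrow> 'a set \<Rightarrow> 'a ops" where
  "induced_ops A F U = {(n, f). poly_op A F n f \<and>
      (\<forall>xs. length xs = n \<and> set xs \<subseteq> U \<longrightarrow> f xs \<in> U)}"

definition idempotent :: "'a set \<Rightarrow> nat \<Rightarrow> ('a list \<Rightarrow> 'a) \<Rightarrow> bool" where
  "idempotent B n p \<longleftrightarrow> (\<forall>x \<in> B. p (replicate n x) = x)"

definition tr_edges :: "'a set \<Rightarrow> nat \<Rightarrow> ('a list \<Rightarrow> 'a) \<Rightarrow> 'a rel" where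
  "tr_edges B n p = {(c, p ((replicate n c)[i := d])) | c d i. c \<in> B \<and> d \<in> B \<and> i < n}"

definition strongly_connected :: "'a set \<Rightarrow> 'a rel \<Rightarrow> bool" where
  "strongly_connected V E \<longleftrightarrow> (\<forall>u \<in> V. \<forall>v \<in> V. (u, v) \<in> E\<^sup>*)"

end

theory Submission
  imports Defs
begin

text \<open>Suppose first that A is solvable. Modulo \<delta> = [\<theta>, \<theta>], the term condition makes the edges of
  Tr(p) inside a \<theta>-class reversible up to directed paths, and then allows the arguments of p to be
  exchanged one at a time, so that p(x, ..., x) = x leads to p(y, ..., y) = y. Going down the derived
  series, each step replaces \<theta>-edges by edges of Tr(p) and \<delta>-edges.

  Conversely, if the derived series stabilizes at some \<theta> different from equality, take \<delta> maximal
  below \<theta> and a minimal set U = e(A) for the pair. A polynomial mapping U to U is then either a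
  permutation of U or collapses \<theta> into \<delta> on U. If s(x, -) collapses and s(y, -) permutes for
  some \<theta>-related x, y, iteration of s produces a polynomial f on U with f(w, a) = w, f(a, z) = z and
  f(w, f(w, z)) = f(w, z), and in Tr(f) no edge enters a from another vertex. Hence there are no such
  twins. But then a failure of the term condition yields a pseudo-addition and a pseudo-subtraction on U,
  and with their help again a pair of forbidden twins; so [\<theta>, \<theta>] is contained in \<delta>, a contradiction.\<close>

section \<open>Polynomial functions\<close>

text \<open>Polynomial functions on an arbitrary domain, with the set G of functions
  playing the part of the projections.\<close>
inductive polf :: "'a set \<Rightarrow> 'a ops \<Rightarrow> ('b \<Rightarrow> 'a) set \<Rightarrow> ('b \<Rightarrow> 'a) \<Rightarrow> bool"
  for C :: "'a set" and F :: "'a ops" and G :: "('b \<Rightarrow> 'a) set" where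
  base: "g \<in> G \<Longrightarrow> polf C F G g"
| const: "c \<in> C \<Longrightarrow> polf C F G (\<lambda>x. c)"
| comp: "(k, g) \<in> F \<Longrightarrow> length hs = k \<Longrightarrow> (\<forall>h \<in> set hs. polf C F G h)
          \<Longrightarrow> polf C F G (\<lambda>x. g (map (\<lambda>h. h x) hs))"

abbreviation projs :: "nat \<Rightarrow> ('a list \<Rightarrow> 'a) set" where
  "projs n \<equiv> (\<lambda>i xs. xs ! i) ` {..<n}"

lemma clo_iff_polf: "clo C F n f \<longleftrightarrow> polf C F (projs n) f"
proof
  show "clo C F n f \<Longrightarrow> polf C F (projs n) f"
  proof (induction rule: clo.induct)
    case (proj i n)
    then show ?case by (intro polf.base) auto
  qed (auto intro: polf.const polf.comp)
  show "polf C F (projs n) f \<Longrightarrow> clo C F n f"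
    by (induction rule: polf.induct) (auto intro: clo.intros)
qed

lemma polf_subst:
  assumes "polf C F G f" and "\<And>g. g \<in> G \<Longrightarrow> polf C F G' (\<lambda>x. g (h x))"
  shows "polf C F G' (\<lambda>x. f (h x))"
  using assms(1)
proof (induction rule: polf.induct)
  case (comp k g hs)
  have "polf C F G' (\<lambda>x. g (map (\<lambda>h. h x) (map (\<lambda>k x. k (h x)) hs)))"
    using comp by (intro polf.comp) auto
  then show ?case by (simp add: comp_def)
qed (auto intro: assms(2) polf.const)

lemma polf_closed:
  assumes "polf A F G f" "is_algebra A F" "\<And>g. g \<in> G \<Longrightarrow> g x \<in> A"
  shows "f x \<in> A"
  using assms(1)
proof (induction rule: polf.induct)
  case (comp k g hs)
  then have "set (map (\<lambda>h. h x) hs) \<subseteq> A" by auto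
  then show ?case using comp(1,2) assms(2) unfolding is_algebra_def by (auto dest: bspec)
qed (auto intro: assms(3))

lemma polf_cong:
  assumes "polf A F G f" "congruence A F \<theta>" "\<And>g. g \<in> G \<Longrightarrow> (g x, g y) \<in> \<theta>"
  shows "(f x, f y) \<in> \<theta>"
  using assms(1)
proof (induction rule: polf.induct)
  case (const c)
  then show ?case using assms(2) by (auto simp: congruence_def equiv_def refl_on_def)
next
  case (comp k g hs)
  then have "list_all2 (\<lambda>x y. (x, y) \<in> \<theta>) (map (\<lambda>h. h x) hs) (map (\<lambda>h. h y) hs)"
    by (simp add: list_all2_conv_all_nth)
  then show ?case using comp(1,2) assms(2) unfolding congruence_def by fastforce
qed (auto intro: assms(3))

lemma polf_comp1:
  assumes "polf C F {\<lambda>x. x} f" "polf C F G h"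
  shows "polf C F G (\<lambda>x. f (h x))"
  using polf_subst[OF assms(1), of G h] assms(2) by auto

abbreviation polf2 :: "'a set \<Rightarrow> 'a ops \<Rightarrow> ('a \<Rightarrow> 'a \<Rightarrow> 'a) \<Rightarrow> bool" where
  "polf2 C F f \<equiv> polf C F {fst, snd} (\<lambda>z. f (fst z) (snd z))"

lemma polf_comp2:
  assumes "polf2 C F f" "polf C F G h" "polf C F G k"
  shows "polf C F G (\<lambda>x. f (h x) (k x))"
proof -
  have "polf C F G (\<lambda>x. f (fst (h x, k x)) (snd (h x, k x)))"
    by (rule polf_subst[OF assms(1), where h = "\<lambda>x. (h x, k x)"]) (use assms(2,3) in auto)
  then show ?thesis by simp
qed

lemma polf_compl:
  assumes "polf C F (projs n) f" "\<And>i. i < n \<Longrightarrow> polf C F G (\<lambda>x. k x ! i)"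
  shows "polf C F G (\<lambda>x. f (k x))"
  using polf_subst[OF assms(1), of G k] assms(2) by auto

text \<open>One distinguished argument and a list of n parameters: the two blocks of the term
  condition, with the first reduced to a single variable.\<close>

abbreviation polfp :: "'a set \<Rightarrow> 'a ops \<Rightarrow> nat \<Rightarrow> ('a \<Rightarrow> 'a list \<Rightarrow> 'a) \<Rightarrow> bool" where
  "polfp C F n f \<equiv> polf C F (insert fst ((\<lambda>g z. g (snd z)) ` projs n)) (\<lambda>z. f (fst z) (snd z))"

lemma polf_compp:
  assumes "polfp C F n f" "polf C F G h" "\<And>i. i < n \<Longrightarrow> polf C F G (\<lambda>x. k x ! i)"
  shows "polf C F G (\<lambda>x. f (h x) (k x))"
proof -
  have "polf C F G (\<lambda>x. f (fst (h x, k x)) (snd (h x, k x)))"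
    by (rule polf_subst[OF assms(1), where h = "\<lambda>x. (h x, k x)"]) (use assms(2,3) in auto)
  then show ?thesis by simp
qed

lemma polf_funpow:
  assumes "polf2 C F s" "polf C F G h" "polf C F G k"
  shows "polf C F G (\<lambda>x. (s (h x) ^^ j) (k x))"
  by (induction j) (auto intro: assms polf_comp2[OF assms(1)])

lemma polf_funpow1:
  assumes "polf C F {\<lambda>x. x} s" "polf C F G k"
  shows "polf C F G (\<lambda>x. (s ^^ j) (k x))"
  by (induction j) (auto intro: assms polf_comp1[OF assms(1)])

lemma polf_update:
  assumes "polf C F G h" "\<And>i. i < n \<Longrightarrow> polf C F G (\<lambda>x. k x ! i)" "i < n" "\<And>x. length (k x) = n"
  shows "polf C F G (\<lambda>x. (k x)[j := h x] ! i)"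
  using assms by (cases "i = j") auto

lemma polf_induced:
  assumes "polf U (induced_ops A F U) G p" "U \<subseteq> A"
  shows "polf A F G p"
  using assms(1)
proof (induction rule: polf.induct)
  case (comp k g hs)
  have "polf A F (projs k) g" using comp(1) by (simp add: induced_ops_def clo_iff_polf)
  then show ?case using comp by (auto intro!: polf_compl[of A F k g])
qed (use assms(2) in \<open>auto intro: polf.base polf.const\<close>)

lemma polf_induced_closed:
  assumes "polf U (induced_ops A F U) (projs n) p" "length xs = n" "set xs \<subseteq> U"
  shows "p xs \<in> U"
proof (rule polf_closed[OF assms(1)])
  show "is_algebra U (induced_ops A F U)" by (auto simp: is_algebra_def induced_ops_def)
qed (use assms in auto)

section \<open>Iteration of self-maps of a finite set\<close>

lemma funpow_closed: "(\<And>x. x \<in> U \<Longrightarrow> f x \<in> U) \<Longrightarrow> x \<in> U \<Longrightarrow> (f ^^ j) x \<in> U"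
  by (induction j) auto

text \<open>Every orbit of a self-map of an n-element set has preperiod and period at most n,
  and n! is a multiple of the period.\<close>
lemma idempotent_exponent:
  assumes "finite U"
  obtains m where "m > 0"
    and "\<And>f x. (\<And>y. y \<in> U \<Longrightarrow> f y \<in> U) \<Longrightarrow> x \<in> U \<Longrightarrow> (f ^^ m) ((f ^^ m) x) = (f ^^ m) x"
proof
  let ?n = "card U" and ?m = "fact (card U) :: nat"
  show "?m > 0" by simp
  fix f x assume f: "\<And>y. y \<in> U \<Longrightarrow> f y \<in> U" and x: "x \<in> U"
  have "\<not> inj_on (\<lambda>j. (f ^^ j) x) {..?n}"
  proof
    assume "inj_on (\<lambda>j. (f ^^ j) x) {..?n}"
    then have "card {..?n} \<le> card U"
      by (rule card_inj_on_le) (use assms funpow_closed[of U f] f x in auto)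
    then show False by simp
  qed
  then obtain i j where ij: "i < j" "j \<le> ?n" "(f ^^ i) x = (f ^^ j) x"
    unfolding inj_on_def by (metis atMost_iff linorder_neq_iff)
  have per: "(f ^^ (i + k * (j - i))) x = (f ^^ i) x" for k
  proof (induction k)
    case (Suc k)
    have "(f ^^ (i + Suc k * (j - i))) x = (f ^^ ((j - i) + (i + k * (j - i)))) x"
      by (simp add: ac_simps)
    also have "\<dots> = (f ^^ (j - i)) ((f ^^ i) x)" using Suc by (simp add: funpow_add)
    also have "\<dots> = (f ^^ (j - i + i)) x" by (simp only: funpow_add comp_def)
    finally show ?case using ij by simp
  qed simp
  have "j - i dvd ?m" using ij by (intro dvd_fact) auto
  then obtain k where k: "?m = k * (j - i)" by (metis dvd_def mult.commute)
  have "i \<le> ?m" using ij fact_ge_self[of ?n] by linarith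
  then have "?m = (?m - i) + i" by simp
  then have "(f ^^ ?m) ((f ^^ ?m) x) = (f ^^ ((?m - i) + (i + ?m))) x"
    by (metis add.assoc comp_apply funpow_add)
  also have "\<dots> = (f ^^ (?m - i)) ((f ^^ (i + k * (j - i))) x)" by (simp only: funpow_add k comp_def)
  also have "\<dots> = (f ^^ (?m - i)) ((f ^^ i) x)" by (simp only: per)
  also have "\<dots> = (f ^^ (?m - i + i)) x" by (simp only: funpow_add comp_def)
  finally show "(f ^^ ?m) ((f ^^ ?m) x) = (f ^^ ?m) x" using \<open>i \<le> ?m\<close> by simp
qed

text \<open>Changes a into b one coordinate at a time through the lists
  \<open>take k b @ drop k a\<close>, so that a preorder Q only has to be checked when a single
  coordinate moves.\<close>

lemma hybrid_path:
  assumes "length a = n" "length b = n"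
    and "\<And>xs. Q xs xs" "\<And>xs ys zs. Q xs ys \<Longrightarrow> Q ys zs \<Longrightarrow> Q xs zs"
    and step: "\<And>zs i. length zs = n \<Longrightarrow> (\<And>j. j < n \<Longrightarrow> zs ! j = a ! j \<or> zs ! j = b ! j) \<Longrightarrow> i < n
      \<Longrightarrow> Q (zs[i := a ! i]) (zs[i := b ! i])"
  shows "Q a b"
proof -
  have "k \<le> n \<Longrightarrow> Q a (take k b @ drop k a)" for k
  proof (induction k)
    case (Suc k)
    let ?z = "take k b @ drop k a"
    have "?z[k := a ! k] = ?z" "?z[k := b ! k] = take (Suc k) b @ drop (Suc k) a"
      using Suc.prems assms(1,2)
      by (auto simp: list_eq_iff_nth_eq nth_list_update nth_append less_Suc_eq)
    moreover have "Q (?z[k := a ! k]) (?z[k := b ! k])"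
      using Suc.prems assms(1,2) by (intro step) (auto simp: nth_append)
    ultimately show ?case using Suc assms(4) by (metis Suc_leD)
  qed (use assms in simp)
  from this[of n] show ?thesis using assms(1,2) by simp
qed

section \<open>Congruences and the term condition\<close>

text \<open>With the other arguments frozen as constants, a basic operation is a unary polynomial,
  so exchanging its arguments one at a time stays inside \<theta>.\<close>

lemma congruenceI:
  assumes "is_algebra A F" "equiv A \<theta>"
    and un: "\<And>f x y. polf A F {\<lambda>x. x} f \<Longrightarrow> (x, y) \<in> \<theta> \<Longrightarrow> (f x, f y) \<in> \<theta>"
  shows "congruence A F \<theta>"
  unfolding congruence_def
proof (intro conjI ballI, fact, clarify)
  fix f xs ys
  assume f: "(length xs, f) \<in> F" and l: "length ys = length xs"
    and r: "list_all2 (\<lambda>x y. (x, y) \<in> \<theta>) xs ys"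
  have sub: "\<theta> \<subseteq> A \<times> A" and tr: "trans \<theta>" and rf: "refl_on A \<theta>"
    using assms(2) by (auto simp: equiv_def)
  have xy: "(xs ! i, ys ! i) \<in> \<theta>" if "i < length xs" for i
    using r that by (simp add: list_all2_conv_all_nth)
  let ?Q = "\<lambda>us vs. us = vs \<or> (f us, f vs) \<in> \<theta>"
  have "?Q xs ys"
  proof (rule hybrid_path[of xs "length xs" ys ?Q])
    fix zs i assume z: "length zs = length xs"
      "\<And>j. j < length xs \<Longrightarrow> zs ! j = xs ! j \<or> zs ! j = ys ! j" "i < length xs"
    have zA: "zs ! j \<in> A" if "j < length xs" for j using z(2)[OF that] xy[OF that] sub by auto
    have "polf A F {\<lambda>x. x} (\<lambda>x. f (map (\<lambda>h. h x) (map (\<lambda>j x. zs[i := x] ! j) [0..<length zs])))"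
    proof (intro polf.comp)
      show "\<forall>h\<in>set (map (\<lambda>j x. zs[i := x] ! j) [0..<length zs]). polf A F {\<lambda>x. x} h"
        using zA z by (auto intro!: polf_update[where n = "length xs"] intro: polf.base polf.const)
    qed (use f z in auto)
    moreover have "map (\<lambda>h. h x) (map (\<lambda>j x. zs[i := x] ! j) [0..<length zs]) = zs[i := x]" for x
      using map_nth[of "zs[i := x]"] by (simp add: comp_def)
    ultimately have "polf A F {\<lambda>x. x} (\<lambda>x. f (zs[i := x]))" by simp
    from un[OF this xy[OF z(3)]] show "?Q (zs[i := xs ! i]) (zs[i := ys ! i])" by simp
  qed (use l tr in \<open>auto dest: transD\<close>)
  moreover have "set xs \<subseteq> A" using xy sub by (fastforce simp: in_set_conv_nth)
  then have "f xs \<in> A" using assms(1) f unfolding is_algebra_def by (auto dest: bspec)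
  ultimately show "(f xs, f ys) \<in> \<theta>" using rf by (auto simp: refl_on_def)
qed

text \<open>The term condition speaks of terms only, so the constants of a polynomial are turned
  into the extra arguments \<open>ks\<close>.\<close>

lemma polf_as_term:
  assumes "polf (set ks) F (set gs) f"
  shows "\<exists>t. clo {} F (length ks + length gs) t \<and> (\<forall>z. f z = t (ks @ map (\<lambda>g. g z) gs))"
  using assms
proof (induction rule: polf.induct)
  case (base g)
  then obtain i where "i < length gs" "gs ! i = g" by (auto simp: in_set_conv_nth)
  then show ?case
    by (intro exI[of _ "\<lambda>xs. xs ! (length ks + i)"]) (auto intro: clo.proj simp: nth_append)
next
  case (const c)
  then obtain i where "i < length ks" "ks ! i = c" by (auto simp: in_set_conv_nth)
  then show ?case
    by (intro exI[of _ "\<lambda>xs. xs ! i"]) (auto intro: clo.proj simp: nth_append)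
next
  case (comp k g hs)
  then obtain T where T: "\<And>h. h \<in> set hs \<Longrightarrow> clo {} F (length ks + length gs) (T h)
      \<and> (\<forall>z. h z = T h (ks @ map (\<lambda>g. g z) gs))"
    by metis
  have "clo {} F (length ks + length gs) (\<lambda>xs. g (map (\<lambda>h. h xs) (map T hs)))"
    using comp T by (intro clo.comp) auto
  moreover have "map (\<lambda>h. h z) hs = map (\<lambda>h. h (ks @ map (\<lambda>g. g z) gs)) (map T hs)" for z
    using T by auto
  ultimately show ?case by (intro exI conjI allI) (assumption, simp only:)
qed

text \<open>The term condition passes to polynomials: all elements of the finite set A join the
  first block as constants, which reflexivity of \<alpha> lets stay fixed. Of the points a, b, c, d
  only the images under \<open>gs\<close> and \<open>hs\<close> enter.\<close>

lemma centralizes_polf: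
  assumes C: "centralizes F \<alpha> \<beta> \<delta>" and A: "finite A" "refl_on A \<alpha>"
    and f: "polf A F ((\<lambda>g z. g (fst z)) ` set gs \<union> (\<lambda>g z. g (snd z)) ` set hs) f"
    and ab: "\<And>g. g \<in> set gs \<Longrightarrow> (g a, g b) \<in> \<alpha>" and cd: "\<And>h. h \<in> set hs \<Longrightarrow> (h c, h d) \<in> \<beta>"
    and eq: "(f (a, c), f (a, d)) \<in> \<delta>"
  shows "(f (b, c), f (b, d)) \<in> \<delta>"
proof -
  obtain ks where ks: "set ks = A" using A finite_list by blast
  let ?gs = "map (\<lambda>g z. g (fst z)) gs @ map (\<lambda>g z. g (snd z)) hs"
  have "polf (set ks) F (set ?gs) f" using f ks by simp
  then obtain t where t: "clo {} F (length ks + length ?gs) t"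
    "\<And>z. f z = t (ks @ map (\<lambda>g. g z) ?gs)" using polf_as_term by blast
  let ?l = "\<lambda>x. ks @ map (\<lambda>g. g x) gs" and ?r = "\<lambda>y. map (\<lambda>g. g y) hs"
  have f: "f (x, y) = t (?l x @ ?r y)" for x y by (simp add: t(2) comp_def)
  have "clo {} F ((length ks + length gs) + length hs) t" using t(1) by (simp add: add.assoc)
  moreover have "list_all2 (\<lambda>x y. (x, y) \<in> \<alpha>) (?l a) (?l b)"
    using ab A(2) ks by (intro list_all2_appendI) (auto simp: list_all2_conv_all_nth refl_on_def)
  moreover have "list_all2 (\<lambda>x y. (x, y) \<in> \<beta>) (?r c) (?r d)"
    using cd by (auto simp: list_all2_conv_all_nth)
  moreover have "length (?l a) = length ks + length gs" "length (?l b) = length ks + length gs"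
    "length (?r c) = length hs" "length (?r d) = length hs" by simp_all
  moreover have "(t (?l a @ ?r c), t (?l a @ ?r d)) \<in> \<delta>" using eq by (simp only: f)
  ultimately have "(t (?l b @ ?r c), t (?l b @ ?r d)) \<in> \<delta>"
    using C unfolding centralizes_def by blast
  then show ?thesis by (simp only: f)
qed

section \<open>Commutators of congruences and the derived series\<close>

lemma congruence_total: "is_algebra A F \<Longrightarrow> congruence A F (A \<times> A)"
  by (rule congruenceI) (auto intro: polf_closed equivI simp: refl_on_def sym_def trans_def)

lemma congruence_term:
  assumes "congruence A F \<theta>" "clo {} F n t" "length xs = n" "list_all2 (\<lambda>x y. (x, y) \<in> \<theta>) xs ys"
  shows "(t xs, t ys) \<in> \<theta>"
proof -
  have "clo A F n t" using assms(2) by (induction rule: clo.induct) (auto intro: clo.intros)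
  then show ?thesis
    using assms by (intro polf_cong[of A F "projs n" t]) (auto simp: clo_iff_polf list_all2_conv_all_nth)
qed

text \<open>Compatibility of t with \<theta> carries the relation from c and d to the values. This
  is what puts the commutator of \<theta> with itself below \<theta>.\<close>

lemma centralizes_self:
  assumes "congruence A F \<theta>"
  shows "centralizes F \<theta> \<theta> \<theta>"
  unfolding centralizes_def
proof (intro allI impI, elim conjE)
  fix m n t a b c d
  assume h: "clo {} F (m + n) t" "length a = m" "length b = m" "length c = n" "length d = n"
    "list_all2 (\<lambda>x y. (x, y) \<in> \<theta>) a b" "list_all2 (\<lambda>x y. (x, y) \<in> \<theta>) c d"
  have rf: "refl_on A \<theta>" and sub: "\<theta> \<subseteq> A \<times> A"
    using assms by (auto simp: congruence_def equiv_def)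
  have "list_all2 (\<lambda>x y. (x, y) \<in> \<theta>) b b"
    using h(6) rf sub by (auto simp: list_all2_conv_all_nth refl_on_def) blast
  then show "(t (b @ c), t (b @ d)) \<in> \<theta>"
    using h by (intro congruence_term[OF assms h(1)]) (auto intro: list_all2_appendI)
qed

lemma congruence_Inter:
  assumes "S \<noteq> {}" "\<And>\<delta>. \<delta> \<in> S \<Longrightarrow> congruence A F \<delta>"
  shows "congruence A F (\<Inter>S)"
proof -
  have "equiv A \<delta>" if "\<delta> \<in> S" for \<delta> using assms(2)[OF that] by (simp add: congruence_def)
  then have "equiv A (\<Inter>S)"
    using assms(1) unfolding equiv_def refl_on_def sym_def trans_def by (intro conjI) (blast+)
  moreover have "(f xs, f ys) \<in> \<Inter>S"
    if "(k, f) \<in> F" "length xs = k" "length ys = k"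
      "list_all2 (\<lambda>x y. (x, y) \<in> \<Inter>S) xs ys" for k f xs ys
  proof
    fix \<delta> assume d: "\<delta> \<in> S"
    have "list_all2 (\<lambda>x y. (x, y) \<in> \<delta>) xs ys"
      using that(4) d by (auto elim: list_all2_mono)
    then show "(f xs, f ys) \<in> \<delta>"
      using assms(2)[OF d] that(1-3) unfolding congruence_def by blast
  qed
  ultimately show ?thesis unfolding congruence_def by blast
qed

lemma centralizes_Inter:
  assumes "\<And>\<delta>. \<delta> \<in> S \<Longrightarrow> centralizes F \<alpha> \<beta> \<delta>"
  shows "centralizes F \<alpha> \<beta> (\<Inter>S)"
  unfolding centralizes_def
proof (intro allI impI InterI)
  fix m n t a b c d \<delta>
  assume h: "term_op F (m + n) t \<and> length a = m \<and> length b = m \<and>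
    list_all2 (\<lambda>x y. (x, y) \<in> \<alpha>) a b \<and> length c = n \<and> length d = n \<and>
    list_all2 (\<lambda>x y. (x, y) \<in> \<beta>) c d \<and> (t (a @ c), t (a @ d)) \<in> \<Inter>S" and "\<delta> \<in> S"
  then have "(t (a @ c), t (a @ d)) \<in> \<delta>" by blast
  then show "(t (b @ c), t (b @ d)) \<in> \<delta>"
    using h assms[OF \<open>\<delta> \<in> S\<close>] unfolding centralizes_def by blast
qed

text \<open>\<theta> belongs to the family that is intersected, and both defining properties of the
  family survive intersections.\<close>

lemma commutator_congruence:
  assumes "is_algebra A F" "congruence A F \<theta>"
  shows "congruence A F (commutator A F \<theta> \<theta>)" "centralizes F \<theta> \<theta> (commutator A F \<theta> \<theta>)"
    "commutator A F \<theta> \<theta> \<subseteq> \<theta>"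
proof -
  let ?S = "{\<delta>. congruence A F \<delta> \<and> centralizes F \<theta> \<theta> \<delta>}"
  have "\<theta> \<in> ?S" using assms centralizes_self by blast
  then show "congruence A F (commutator A F \<theta> \<theta>)" "commutator A F \<theta> \<theta> \<subseteq> \<theta>"
    unfolding commutator_def by (intro congruence_Inter, auto)
  show "centralizes F \<theta> \<theta> (commutator A F \<theta> \<theta>)"
    unfolding commutator_def by (rule centralizes_Inter) auto
qed

lemma derived_congruence: "is_algebra A F \<Longrightarrow> congruence A F (derived A F k)"
  by (induction k) (auto intro: congruence_total commutator_congruence)


lemma polf2_cong:
  assumes "polf2 A F f" "congruence A F \<theta>" "(a, a') \<in> \<theta>" "(b, b') \<in> \<theta>"
  shows "(f a b, f a' b') \<in> \<theta>"
proof -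
  have "(f (fst (a, b)) (snd (a, b)), f (fst (a', b')) (snd (a', b'))) \<in> \<theta>"
    by (rule polf_cong[OF assms(1,2)]) (use assms(3,4) in auto)
  then show ?thesis by simp
qed

section \<open>Solvability implies strong connectivity\<close>

text \<open>One step down the derived series, with \<delta> in the role of [\<theta>, \<theta>].
  Idempotence turns a path from p(x, ..., x) to p(y, ..., y) into one from x to y.\<close>

lemma tr_edges_mod:
  fixes A :: "'a set"
  assumes alg: "is_algebra A F" and fin: "finite A" and UA: "U \<subseteq> A"
    and p: "polf U (induced_ops A F U) (projs n) p" and idem: "idempotent U n p"
    and ct: "congruence A F \<theta>" and C: "centralizes F \<theta> \<theta> \<delta>"
    and rd: "refl_on A \<delta>" "sym \<delta>"
    and xy: "(x, y) \<in> \<theta>" "x \<in> U" "y \<in> U"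
  shows "(x, y) \<in> (tr_edges U n p \<union> \<delta> \<inter> U \<times> U)\<^sup>*"
proof -
  define R where "R = (tr_edges U n p \<union> \<delta> \<inter> U \<times> U)\<^sup>*"
  \<comment> \<open>\<open>lam i v\<close> sends u to the end of the edge out of u that puts v into
    position i, so its iterates follow directed paths; v is a fixed point by idempotence.\<close>
  define lam where "lam i y x = p ((replicate n x)[i := y])" for i y x
  have rt: "refl_on A \<theta>" and st: "sym \<theta>" and tt: "trans \<theta>"
    using ct by (auto simp: congruence_def equiv_def)
  have RT: "(a, c) \<in> R" if "(a, b) \<in> R" "(b, c) \<in> R" for a b c
    using that unfolding R_def by (rule rtrancl_trans)
  have R\<delta>: "(a, b) \<in> R" if "(a, b) \<in> \<delta>" "a \<in> U" "b \<in> U" for a b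
    using that unfolding R_def by blast
  have polp: "polf A F (projs n) p" using polf_induced[OF p UA] .
  have pU: "p xs \<in> U" if "length xs = n" "set xs \<subseteq> U" for xs
    using polf_induced_closed[OF p that] .
  have pol: "polf2 A F (lam i)" if "i < n" for i
    unfolding lam_def
  proof (rule polf_compl[OF polp])
    fix j assume "j < n"
    then show "polf A F {fst, snd} (\<lambda>z. (replicate n (snd z))[i := fst z] ! j)"
      by (intro polf_update[where n = n]) (auto intro: polf.base)
  qed
  have lU: "lam i v u \<in> U" if "i < n" "v \<in> U" "u \<in> U" for i v u
    unfolding lam_def by (rule pU) (use that in \<open>auto dest!: subsetD[OF set_update_subset_insert]\<close>)
  have lUp: "(lam i v ^^ j) u \<in> U" if "i < n" "v \<in> U" "u \<in> U" for i v u j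
    using lU that by (intro funpow_closed) auto
  have lxx: "lam i v v = v" if "v \<in> U" "i < n" for i v
    using idem that list_update_id[of "replicate n v" i] by (simp add: lam_def idempotent_def)
  have lxxp: "(lam i v ^^ j) v = v" if "v \<in> U" "i < n" for i v j
    by (induction j) (auto simp: lxx that)
  have edge: "(u, lam i v u) \<in> R" if "i < n" "v \<in> U" "u \<in> U" for i v u
    using that unfolding R_def tr_edges_def lam_def by blast
  have path: "(u, (lam i v ^^ j) u) \<in> R" if "i < n" "v \<in> U" "u \<in> U" for i v u j
  proof (induction j)
    case (Suc j)
    then show ?case using RT[OF Suc edge[OF that(1,2) lUp[OF that]]] by simp
  qed (simp add: R_def)
  have l\<theta>: "(lam i v u, v) \<in> \<theta>" if "i < n" "(u, v) \<in> \<theta>" "v \<in> U" for i v u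
  proof -
    have "(v, v) \<in> \<theta>" using that UA rt by (auto simp: refl_on_def)
    then have "(lam i v u, lam i v v) \<in> \<theta>"
      using polf2_cong[OF pol[OF that(1)] ct] that by blast
    then show ?thesis using lxx that by simp
  qed
  have l\<theta>p: "((lam i v ^^ j) u, v) \<in> \<theta>" if "i < n" "(u, v) \<in> \<theta>" "v \<in> U" for i v u j
    by (induction j) (use that l\<theta> in auto)
  obtain m where m: "m > 0"
    "\<And>f x. (\<And>y. y \<in> U \<Longrightarrow> f y \<in> U) \<Longrightarrow> x \<in> U \<Longrightarrow> (f ^^ m) ((f ^^ m) x) = (f ^^ m) x"
    using idempotent_exponent[of U] finite_subset[OF UA fin] by metis
  have lm: "(lam i v ^^ m) ((lam i v ^^ m) u) = (lam i v ^^ m) u"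
    if "i < n" "v \<in> U" "u \<in> U" for i v u
    using m(2) lU that by auto
  have rev1: "(lam i v u, u) \<in> R" if i: "i < n" and v: "v \<in> U" "u \<in> U" "(u, v) \<in> \<theta>" for i v u
  proof -
    let ?z = "(lam i v ^^ m) u" and ?f = "\<lambda>z. (lam i (fst z) ^^ m) (snd z)"
    have uv: "(v, u) \<in> \<theta>" "(u, ?z) \<in> \<theta>" using v l\<theta>p[OF i v(3,1)] st tt by (blast dest: symD transD)+
    have zU: "?z \<in> U" using lUp i v by auto
    have fp: "polf A F {fst, snd} ?f"
      by (rule polf_funpow[OF pol[OF i]]) (auto intro: polf.base)
    \<comment> \<open>From u, iterate towards v; the term condition says that iterating back towards u
      returns to u modulo \<delta>, because ?f (v, u) = ?f (v, ?z) and ?f (u, u) = u.\<close>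
    have "(?f (u, u), ?f (u, ?z)) \<in> \<delta>"
    proof (rule centralizes_polf[OF C fin rt, of "[\<lambda>x. x]" "[\<lambda>x. x]" ?f v u u ?z])
      show "(?f (v, u), ?f (v, ?z)) \<in> \<delta>"
        using lm[OF i v(1,2)] zU UA rd by (auto simp: refl_on_def)
    qed (use fp uv in \<open>auto simp: insert_commute\<close>)
    then have "(u, (lam i u ^^ m) ?z) \<in> \<delta>" using lxxp[OF v(2) i] by simp
    then have "((lam i u ^^ m) ?z, u) \<in> R" using R\<delta> rd v lUp[OF i v(2) zU] by (blast dest: symD)
    moreover have "(?z, (lam i u ^^ m) ?z) \<in> R" using path i v zU by blast
    moreover have "(lam i v u, ?z) \<in> R"
    proof -
      have "?z = (lam i v ^^ (m - 1)) (lam i v u)" using m(1)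
        by (metis Suc_pred' comp_apply funpow_Suc_right)
      then show ?thesis using path[OF i v(1) lU[OF i v(1,2)]] by metis
    qed
    ultimately show ?thesis using RT by blast
  qed
  have rev: "((lam i v ^^ j) u, u) \<in> R" if i: "i < n" and v: "v \<in> U" "u \<in> U" "(u, v) \<in> \<theta>" for i v u j
  proof (induction j)
    case (Suc j)
    then show ?case using RT[OF rev1[OF i v(1) lUp[OF i v(1,2)] l\<theta>p[OF i v(3,1)]] Suc] by simp
  qed (simp add: R_def)
  have "(p (replicate n x), p (replicate n y)) \<in> R"
  proof (rule hybrid_path[of _ n _ "\<lambda>us vs. (p us, p vs) \<in> R"])
    fix zs i assume z: "length zs = n" "i < n"
      and "\<And>j. j < n \<Longrightarrow> zs ! j = replicate n x ! j \<or> zs ! j = replicate n y ! j"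
    then have zj: "zs ! j = x \<or> zs ! j = y" if "j < n" for j using that by auto
    then have zU: "set zs \<subseteq> U" using z xy by (auto simp: in_set_conv_nth) metis
    let ?q = "p (zs[i := x])" and ?q' = "p (zs[i := y])"
    \<comment> \<open>Chosen such that ?q and the diagonal value lam i x w = p(w, ..., x, ..., w) have the same image
      under the m-th iterate of lam i x; the term condition then replaces x by y.\<close>
    define w where "w = (lam i x ^^ (m - 1)) ?q"
    \<comment> \<open>Unlike \<open>us[i := v]\<close>, this has the coordinates v and
      \<open>us ! j\<close> for lists us of every length, as a polynomial function on all lists
      requires.\<close>
    let ?upd = "\<lambda>v us. map (\<lambda>j. if j = i then v else us ! j) [0..<n]"
    have upd: "?upd v us = us[i := v]" if "length us = n" for v us
      using that by (auto simp: list_eq_iff_nth_eq nth_list_update)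
    let ?f = "\<lambda>z. (lam i (fst z) ^^ m) (p (?upd (fst z) (snd z)))"
    have xx: "(x, x) \<in> \<theta>" "(y, x) \<in> \<theta>" using xy UA rt st by (auto simp: refl_on_def dest: symD)
    have qU: "?q \<in> U" "?q' \<in> U"
      using zU z xy by (auto intro!: pU dest!: subsetD[OF set_update_subset_insert])
    have q\<theta>: "(p (zs[i := v]), x) \<in> \<theta>" if "(v, x) \<in> \<theta>" for v
    proof -
      have "(zs[i := v] ! j, replicate n x ! j) \<in> \<theta>" if "j < n" for j
        using zj[OF that] that xx \<open>(v, x) \<in> \<theta>\<close> z by (auto simp: nth_list_update)
      then have "(p (zs[i := v]), p (replicate n x)) \<in> \<theta>"
        by (intro polf_cong[OF polp ct]) auto
      then show ?thesis using idem xy by (simp add: idempotent_def)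
    qed
    have wU: "w \<in> U" and wx: "(w, x) \<in> \<theta>" unfolding w_def
      using lUp[OF z(2) xy(2) qU(1)] l\<theta>p[OF z(2) q\<theta>[OF xx(1)] xy(2)] by auto
    have fp: "polf A F ((\<lambda>g z. g (fst z)) ` set [\<lambda>x. x] \<union>
        (\<lambda>g z. g (snd z)) ` set (map (\<lambda>j us. us ! j) [0..<n])) ?f" (is "polf A F ?G _")
    proof (intro polf_funpow[OF pol[OF z(2)]])
      have f1: "polf A F ?G fst" and f2: "j < n \<Longrightarrow> polf A F ?G (\<lambda>z. snd z ! j)" for j
        by (auto intro: polf.base)
      show "polf A F ?G (\<lambda>x. fst x)" using f1 by simp
      show "polf A F ?G (\<lambda>z. p (?upd (fst z) (snd z)))"
      proof (rule polf_compl[OF polp])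
        fix j assume j: "j < n"
        then have eq: "(\<lambda>z. ?upd (fst z) (snd z) ! j) = (if j = i then fst else (\<lambda>z. snd z ! j))"
          by auto
        show "polf A F ?G (\<lambda>z. ?upd (fst z) (snd z) ! j)" unfolding eq using f1 f2[OF j] by simp
      qed
    qed
    have wn: "p ((replicate n w)[i := v]) = lam i v w" for v by (simp add: lam_def)
    have "(?f (y, zs), ?f (y, replicate n w)) \<in> \<delta>"
    proof (rule centralizes_polf[OF C fin rt fp, of x])
      have "?f (x, replicate n w) = (lam i x ^^ m) (lam i x w)" by (simp add: upd wn)
      also have "\<dots> = (lam i x ^^ (m + 1 + (m - 1))) ?q" by (simp add: w_def funpow_add funpow_swap1)
      also have "m + 1 + (m - 1) = m + m" using m(1) by simp
      also have "(lam i x ^^ (m + m)) ?q = (lam i x ^^ m) ?q"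
        using lm[OF z(2) xy(2) qU(1)] by (simp add: funpow_add)
      finally show "(?f (x, zs), ?f (x, replicate n w)) \<in> \<delta>"
        using lUp[OF z(2) xy(2) qU(1)] UA rd z by (auto simp: refl_on_def upd)
    next
      fix h :: "'a list \<Rightarrow> 'a" assume "h \<in> set (map (\<lambda>j us. us ! j) [0..<n])"
      then obtain j where j: "j < n" "h = (\<lambda>us. us ! j)" by auto
      have "(x, w) \<in> \<theta>" "(y, w) \<in> \<theta>" using xx wx st tt by (meson symD transD)+
      then show "(h zs, h (replicate n w)) \<in> \<theta>" using zj[OF j(1)] j by auto
    qed (use xy in auto)
    then have \<delta>: "((lam i y ^^ m) ?q', (lam i y ^^ m) (lam i y w)) \<in> \<delta>" by (simp add: wn upd z)
    have lw: "lam i y w \<in> U" using lU z xy wU by blast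
    \<comment> \<open>The path goes from \<open>?q\<close> to w, over the edge that puts y into
      position i, on along iterates of \<open>lam i y\<close>, across \<delta>, and back to
      \<open>?q'\<close> along reversed edges.\<close>
    have "(?q, w) \<in> R" unfolding w_def using path z xy qU by blast
    moreover have "(w, lam i y w) \<in> R" using edge z xy wU by blast
    moreover have "(lam i y w, (lam i y ^^ m) (lam i y w)) \<in> R" using path z xy lw by blast
    moreover have "((lam i y ^^ m) (lam i y w), (lam i y ^^ m) ?q') \<in> R"
      using \<delta> R\<delta> rd lUp z xy lw qU by (blast dest: symD)
    moreover have "((lam i y ^^ m) ?q', ?q') \<in> R"
      using rev[OF z(2) xy(3) qU(2)] q\<theta>[OF xx(2)] xy(1) tt by (blast dest: transD)
    ultimately show "(p (zs[i := replicate n x ! i]), p (zs[i := replicate n y ! i])) \<in> R"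
      using RT z by (metis nth_replicate)
  qed (auto simp: R_def)
  then show ?thesis using idem xy by (simp add: idempotent_def R_def)
qed

lemma solvable_imp_strongly_connected:
  assumes alg: "is_algebra A F" and fin: "finite A" and UA: "U \<subseteq> A" and "solvable A F"
    and p: "polf U (induced_ops A F U) (projs n) p" and idem: "idempotent U n p"
  shows "strongly_connected U (tr_edges U n p)"
proof -
  \<comment> \<open>Reachability by edges of Tr(p) and pairs of the k-th derived congruence. It is
    total for every k; once that congruence is equality, only edges of Tr(p) are left.\<close>
  let ?R = "\<lambda>k. (tr_edges U n p \<union> derived A F k \<inter> U \<times> U)\<^sup>*"
  have "U \<times> U \<subseteq> ?R k" for k
  proof (induction k)
    case 0
    then show ?case using UA by auto
  next
    case (Suc k)
    note c = derived_congruence[OF alg, of k]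
    note d = commutator_congruence[OF alg c]
    have rd: "refl_on A (derived A F (Suc k))" "sym (derived A F (Suc k))"
      using d(1) by (auto simp: congruence_def equiv_def)
    have "derived A F k \<inter> U \<times> U \<subseteq> ?R (Suc k)"
      using tr_edges_mod[OF alg fin UA p idem c _ rd] d(2) by auto
    then have "?R k \<subseteq> ?R (Suc k)" by (intro rtrancl_subset_rtrancl) auto
    then show ?case using Suc by blast
  qed
  moreover obtain k where k: "derived A F k = Id_on A" using assms(4) by (auto simp: solvable_def)
  have "?R k \<subseteq> (tr_edges U n p)\<^sup>*" unfolding k by (rule rtrancl_subset_rtrancl) auto
  ultimately show ?thesis unfolding strongly_connected_def by blast
qed


section \<open>Prime quotients of congruences\<close>

abbreviation pol1 :: "'a set \<Rightarrow> 'a ops \<Rightarrow> ('a \<Rightarrow> 'a) \<Rightarrow> bool" where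
  "pol1 A F \<equiv> polf A F {\<lambda>x. x}"

lemma pol1_id: "pol1 A F (\<lambda>x. x)"
  by (rule polf.base) simp

lemma pol1_cong: "pol1 A F f \<Longrightarrow> congruence A F \<theta> \<Longrightarrow> (x, y) \<in> \<theta> \<Longrightarrow> (f x, f y) \<in> \<theta>"
  by (rule polf_cong[of A F "{\<lambda>x. x}" f]) auto

lemma pol1_closed: "pol1 A F f \<Longrightarrow> is_algebra A F \<Longrightarrow> x \<in> A \<Longrightarrow> f x \<in> A"
  by (rule polf_closed[of A F "{\<lambda>x. x}" f]) auto

lemma inj_on_funpow_closed:
  assumes "inj_on f U" "f ` U \<subseteq> U"
  shows "inj_on (f ^^ j) U"
proof (induction j)
  case (Suc j)
  have "inj_on f ((f ^^ j) ` U)"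
    using assms(2) funpow_closed[of U f] by (intro inj_on_subset[OF assms(1)]) blast
  with Suc show ?case using comp_inj_on[of "f ^^ j" U f] by (simp only: funpow.simps)
qed simp

text \<open>An idempotent power of an injective map is the identity, so the power m - 1 inverts it.
  Inverses of polynomial permutations of U are thus polynomial, by one exponent for all
  self-maps.\<close>

lemma exponent:
  assumes "finite U"
  obtains m where "m > 0"
    and "\<And>f x. f ` U \<subseteq> U \<Longrightarrow> x \<in> U \<Longrightarrow> (f ^^ m) ((f ^^ m) x) = (f ^^ m) x"
    and "\<And>f x. f ` U \<subseteq> U \<Longrightarrow> inj_on f U \<Longrightarrow> x \<in> U \<Longrightarrow> (f ^^ m) x = x"
    and "\<And>(f :: 'a \<Rightarrow> 'a) x. (f ^^ (m - Suc 0)) (f x) = (f ^^ m) x"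
proof -
  obtain m where m: "m > 0"
    "\<And>f x. (\<And>y. y \<in> U \<Longrightarrow> f y \<in> U) \<Longrightarrow> x \<in> U \<Longrightarrow> (f ^^ m) ((f ^^ m) x) = (f ^^ m) x"
    using idempotent_exponent[OF assms] by metis
  show thesis
  proof (rule that[OF m(1)])
    show idem: "(f ^^ m) ((f ^^ m) x) = (f ^^ m) x" if "f ` U \<subseteq> U" "x \<in> U" for f x
      using that by (intro m(2)) auto
    show "(f ^^ m) x = x" if f: "f ` U \<subseteq> U" "inj_on f U" "x \<in> U" for f x
    proof (rule inj_onD[OF inj_on_funpow_closed[OF f(2,1)] idem[OF f(1,3)]])
      show "(f ^^ m) x \<in> U" using f by (intro funpow_closed) auto
    qed fact
    show "(f ^^ (m - Suc 0)) (f x) = (f ^^ m) x" for f :: "'a \<Rightarrow> 'a" and x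
      using m(1) by (metis Suc_pred comp_apply funpow_Suc_right)
  qed
qed

lemma polfp_cong:
  assumes "polfp A F n f" "congruence A F \<kappa>" "(w, w') \<in> \<kappa>" "\<And>j. j < n \<Longrightarrow> (zs ! j, zs' ! j) \<in> \<kappa>"
  shows "(f w zs, f w' zs') \<in> \<kappa>"
proof -
  have "(f (fst (w, zs)) (snd (w, zs)), f (fst (w', zs')) (snd (w', zs'))) \<in> \<kappa>"
    by (rule polf_cong[OF assms(1,2)]) (use assms(3,4) in auto)
  then show ?thesis by simp
qed

lemma polfp_closed:
  assumes "polfp A F n f" and alg: "is_algebra A F" and "w \<in> A" "length zs = n" "set zs \<subseteq> A"
  shows "f w zs \<in> A"
proof -
  have "f (fst (w, zs)) (snd (w, zs)) \<in> A"
    by (rule polf_closed[OF assms(1) alg]) (use assms(3-) in auto)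
  then show ?thesis by simp
qed

lemma polfp_section: "polfp A F n f \<Longrightarrow> w \<in> A \<Longrightarrow> polf A F (projs n) (f w)"
  using polf_compp[of A F n f "projs n" "\<lambda>x. w" "\<lambda>x. x"] by (simp add: polf.base polf.const)

lemma polfp_update:
  assumes f: "polfp A F n f" and g: "pol1 A F g" and h: "pol1 A F h"
    and z: "length zs = n" "set zs \<subseteq> A" "i < n"
  shows "polf2 A F (\<lambda>w z. f (g w) (zs[i := h z]))"
proof (rule polf_compp[OF f polf_comp1[OF g]])
  fix j assume j: "j < n"
  show "polf A F {fst, snd} (\<lambda>x. zs[i := h (snd x)] ! j)"
    by (rule polf_update[where n = n, OF polf_comp1[OF h]])
      (use j z in \<open>auto intro!: polf.base polf.const dest: nth_mem\<close>)
qed (auto intro: polf.base)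

locale prime_quotient =
  fixes A :: "'a set" and F :: "'a ops" and \<delta> \<theta> :: "'a rel"
  assumes alg: "is_algebra A F" and fin: "finite A"
    and c\<delta>: "congruence A F \<delta>" and c\<theta>: "congruence A F \<theta>" and sub: "\<delta> \<subseteq> \<theta>"
    and max: "\<And>\<kappa>. congruence A F \<kappa> \<Longrightarrow> \<delta> \<subseteq> \<kappa> \<Longrightarrow> \<kappa> \<subseteq> \<theta> \<Longrightarrow> \<kappa> = \<delta> \<or> \<kappa> = \<theta>"
begin

lemma \<theta>A: "(x, y) \<in> \<theta> \<Longrightarrow> x \<in> A \<and> y \<in> A"
  using c\<theta> by (auto simp: congruence_def equiv_def)

lemma \<delta>A: "(x, y) \<in> \<delta> \<Longrightarrow> x \<in> A \<and> y \<in> A"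
  using \<theta>A sub by blast

lemma \<theta>_refl: "x \<in> A \<Longrightarrow> (x, x) \<in> \<theta>"
  and \<theta>_sym: "(x, y) \<in> \<theta> \<Longrightarrow> (y, x) \<in> \<theta>"
  and \<theta>_trans: "(x, y) \<in> \<theta> \<Longrightarrow> (y, z) \<in> \<theta> \<Longrightarrow> (x, z) \<in> \<theta>"
  using c\<theta> by (auto simp: congruence_def equiv_def refl_on_def dest: symD transD)

lemma \<delta>_refl: "x \<in> A \<Longrightarrow> (x, x) \<in> \<delta>"
  and \<delta>_sym: "(x, y) \<in> \<delta> \<Longrightarrow> (y, x) \<in> \<delta>"
  and \<delta>_trans: "(x, y) \<in> \<delta> \<Longrightarrow> (y, z) \<in> \<delta> \<Longrightarrow> (x, z) \<in> \<delta>"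
  using c\<delta> by (auto simp: congruence_def equiv_def refl_on_def dest: symD transD)

text \<open>An induction principle for \<theta>: the pairs of \<theta> all of whose polynomial
  images lie in Q form a congruence between \<delta> and \<theta>. It contains (u, v), so it is
  \<theta> itself, and the identity polynomial puts it inside Q.\<close>

lemma generation:
  assumes uv: "(u, v) \<in> \<theta>" "(u, v) \<notin> \<delta>" and Q: "equiv A Q" "\<delta> \<subseteq> Q"
    and g: "\<And>g. pol1 A F g \<Longrightarrow> (g u, g v) \<in> Q"
  shows "\<theta> \<subseteq> Q"
proof -
  let ?\<kappa> = "{(x, y). (x, y) \<in> \<theta> \<and> (\<forall>g. pol1 A F g \<longrightarrow> (g x, g y) \<in> Q)}"
  have "congruence A F ?\<kappa>"
  proof (rule congruenceI[OF alg])
    show "equiv A ?\<kappa>"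
    proof (rule equivI)
      show "?\<kappa> \<subseteq> A \<times> A" using \<theta>A by auto
      show "refl_on A ?\<kappa>" using Q(1) \<theta>_refl pol1_closed[OF _ alg]
        by (auto simp: refl_on_def equiv_def)
      show "sym ?\<kappa>" using Q(1) \<theta>_sym by (auto simp: equiv_def intro!: symI dest: symD)
      show "trans ?\<kappa>" using Q(1) \<theta>_trans unfolding equiv_def
        by (intro transI) (blast dest: transD)
    qed
    fix f x y assume f: "pol1 A F f" and xy: "(x, y) \<in> ?\<kappa>"
    then show "(f x, f y) \<in> ?\<kappa>" using pol1_cong[OF f c\<theta>] polf_comp1[OF _ f] by auto
  qed
  moreover have "\<delta> \<subseteq> ?\<kappa>" using Q(2) sub pol1_cong[OF _ c\<delta>] by blast
  moreover have "(u, v) \<in> ?\<kappa>" using uv g by blast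
  ultimately have "?\<kappa> = \<theta>" using max uv by blast
  then show ?thesis using pol1_id by fastforce
qed

text \<open>The requirement that g(u) lies in the class of x is what later allows twins to be
  compared: all parameters stay within one \<theta>-class.\<close>
lemma separating_translation:
  assumes uv: "(u, v) \<in> \<theta>" "(u, v) \<notin> \<delta>" and f: "pol1 A F f" and xy: "(x, y) \<in> \<theta>" "(f x, f y) \<notin> \<delta>"
  obtains g where "pol1 A F g" "(g u, x) \<in> \<theta>" "(f (g u), f (g v)) \<notin> \<delta>"
proof (rule ccontr)
  assume no: "\<not> thesis"
  \<comment> \<open>Q separates the class of x from its complement, compares f modulo \<delta>
    inside the class and identifies everything outside. If no g worked, all images of (u, v) and
    hence (x, y) would lie in Q.\<close>
  let ?Q = "{(a, b). a \<in> A \<and> b \<in> A \<and> ((a, x) \<in> \<theta> \<longleftrightarrow> (b, x) \<in> \<theta>) \<and> ((a, x) \<in> \<theta> \<longrightarrow> (f a, f b) \<in> \<delta>)}"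
  have "\<theta> \<subseteq> ?Q"
  proof (rule generation[OF uv])
    show "equiv A ?Q"
    proof (rule equivI)
      show "refl_on A ?Q" using \<delta>_refl pol1_closed[OF f alg] by (auto simp: refl_on_def)
      show "sym ?Q" using \<delta>_sym by (auto intro: symI)
      show "trans ?Q" by (intro transI) (blast intro: \<delta>_trans)
    qed auto
    show "\<delta> \<subseteq> ?Q" using \<delta>A sub \<theta>_sym \<theta>_trans pol1_cong[OF f c\<delta>] by blast
    fix g assume g: "pol1 A F g"
    have "(g u, g v) \<in> \<theta>" using pol1_cong[OF g c\<theta> uv(1)] .
    then show "(g u, g v) \<in> ?Q" using no that g \<theta>A \<theta>_sym \<theta>_trans by blast
  qed
  then show False using xy \<theta>_refl \<theta>A by blast
qed

text \<open>Among the polynomials separating a pair of \<theta> modulo \<delta>, take f with the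
  smallest image. For some g the composite f g f still separates, so f g permutes the image of f,
  and a power of f g is idempotent with that image.\<close>

lemma minimal_idempotent:
  assumes "\<delta> \<noteq> \<theta>"
  obtains e u0 u1 where "pol1 A F e" "\<And>x. x \<in> A \<Longrightarrow> e (e x) = e x"
    "u0 \<in> e ` A" "u1 \<in> e ` A" "(u0, u1) \<in> \<theta>" "(u0, u1) \<notin> \<delta>"
    "\<And>f x y. pol1 A F f \<Longrightarrow> (x, y) \<in> \<theta> \<Longrightarrow> (f x, f y) \<notin> \<delta> \<Longrightarrow> card (e ` A) \<le> card (f ` A)"
proof -
  let ?P = "\<lambda>f. pol1 A F f \<and> (\<exists>x y. (x, y) \<in> \<theta> \<and> (f x, f y) \<notin> \<delta>)"
  obtain u v where "(u, v) \<in> \<theta>" "(u, v) \<notin> \<delta>" using assms sub by auto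
  then have "?P (\<lambda>x. x)" using pol1_id by blast
  then obtain f where "?P f" and min: "\<And>g. ?P g \<Longrightarrow> card (f ` A) \<le> card (g ` A)"
    using ex_has_least_nat[of ?P _ "\<lambda>f. card (f ` A)"] by blast
  then obtain x y where f: "pol1 A F f" and xy: "(x, y) \<in> \<theta>" "(f x, f y) \<notin> \<delta>" by blast
  let ?U = "f ` A"
  have UA: "?U \<subseteq> A" using pol1_closed[OF f alg] by auto
  have finU: "finite ?U" using fin by simp
  have fxy: "(f x, f y) \<in> \<theta>" using pol1_cong[OF f c\<theta> xy(1)] .
  obtain g where g: "pol1 A F g" "(f (g (f x)), f (g (f y))) \<notin> \<delta>"
    using separating_translation[OF fxy xy(2) f xy] by metis
  define h where "h = (\<lambda>z. f (g z))"
  have h: "pol1 A F h" unfolding h_def by (rule polf_comp1[OF f g(1)])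
  have hU: "h z \<in> ?U" if "z \<in> A" for z unfolding h_def using pol1_closed[OF g(1) alg that] by simp
  have "?P (\<lambda>z. h (f z))" using polf_comp1[OF h f] g(2) xy(1) unfolding h_def by blast
  then have "card ?U \<le> card ((\<lambda>z. h (f z)) ` A)" by (rule min)
  also have "(\<lambda>z. h (f z)) ` A = h ` ?U" by auto
  finally have "card (h ` ?U) = card ?U" using card_image_le[OF finU, of h] by simp
  then have inj: "inj_on h ?U" using eq_card_imp_inj_on[OF finU] by blast
  have hUU: "h ` ?U \<subseteq> ?U" using hU UA by blast
  obtain m where m: "m > 0" "\<And>z. z \<in> ?U \<Longrightarrow> (h ^^ m) z = z"
    "\<And>z. (h ^^ (m - Suc 0)) (h z) = (h ^^ m) z"
  proof (rule exponent[OF finU])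
    fix m :: nat
    assume "m > 0" "\<And>(f :: 'a \<Rightarrow> 'a) x. (f ^^ (m - Suc 0)) (f x) = (f ^^ m) x"
      "\<And>f x. f ` ?U \<subseteq> ?U \<Longrightarrow> inj_on f ?U \<Longrightarrow> x \<in> ?U \<Longrightarrow> (f ^^ m) x = x"
    then show thesis using that[of m] hUU inj by blast
  qed
  \<comment> \<open>On points outside the image the power still lands in it, because the innermost
    application of h does.\<close>
  have mU: "(h ^^ m) z \<in> ?U" if "z \<in> A" for z
    unfolding m(3)[symmetric] using hUU hU[OF that] by (intro funpow_closed) auto
  have eA: "(h ^^ m) ` A = ?U"
  proof
    show "?U \<subseteq> (h ^^ m) ` A" using m(2) UA by (metis image_eqI subsetD subsetI)
  qed (use mU in auto)
  show ?thesis
  proof (rule that[of "h ^^ m" "f x" "f y"])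
    show "pol1 A F (h ^^ m)" using polf_funpow1[OF h pol1_id, of m] by simp
    show "f x \<in> (h ^^ m) ` A" "f y \<in> (h ^^ m) ` A" unfolding eA using \<theta>A[OF xy(1)] by auto
    show "(h ^^ m) ((h ^^ m) z) = (h ^^ m) z" if "z \<in> A" for z using m(2)[OF mU[OF that]] .
    show "card ((h ^^ m) ` A) \<le> card (k ` A)"
      if "pol1 A F k" "(a, b) \<in> \<theta>" "(k a, k b) \<notin> \<delta>" for k a b
      unfolding eA using that by (intro min) blast
  qed (rule fxy xy(2))+
qed

end

section \<open>Twins on a minimal set\<close>

text \<open>\<open>min\<close> makes U a minimal set of the quotient. Strong connectivity enters
  only through \<open>no_pseudo_meet\<close>, where a acts like the top element of a meet
  semilattice.\<close>

locale minimal_set = prime_quotient A F \<delta> \<theta>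
  for A :: "'a set" and F :: "'a ops" and \<delta> \<theta> :: "'a rel" +
  fixes e :: "'a \<Rightarrow> 'a" and u0 u1 :: 'a
  assumes e: "pol1 A F e" and e_idem: "x \<in> A \<Longrightarrow> e (e x) = e x"
    and u0: "u0 \<in> e ` A" and u1: "u1 \<in> e ` A" and u\<theta>: "(u0, u1) \<in> \<theta>" and u\<delta>: "(u0, u1) \<notin> \<delta>"
    and min: "\<And>f x y. pol1 A F f \<Longrightarrow> (x, y) \<in> \<theta> \<Longrightarrow> (f x, f y) \<notin> \<delta> \<Longrightarrow> card (e ` A) \<le> card (f ` A)"
    and no_pseudo_meet: "\<And>f a. polf2 A F f \<Longrightarrow> (\<And>w z. w \<in> e ` A \<Longrightarrow> z \<in> e ` A \<Longrightarrow> f w z \<in> e ` A)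
      \<Longrightarrow> a \<in> e ` A \<Longrightarrow> (\<And>w. w \<in> e ` A \<Longrightarrow> f w a = w) \<Longrightarrow> (\<And>z. z \<in> e ` A \<Longrightarrow> f a z = z)
      \<Longrightarrow> (\<And>w z. w \<in> e ` A \<Longrightarrow> z \<in> e ` A \<Longrightarrow> f w (f w z) = f w z) \<Longrightarrow> e ` A = {a}"
begin

abbreviation "U \<equiv> e ` A"

lemma UA: "x \<in> U \<Longrightarrow> x \<in> A"
  using pol1_closed[OF e alg] by auto

lemma e_on_U: "x \<in> U \<Longrightarrow> e x = x"
  using e_idem by auto

lemma finU: "finite U"
  using fin by simp

lemma polf2_section1: "polf2 A F s \<Longrightarrow> b \<in> A \<Longrightarrow> pol1 A F (\<lambda>w. s w b)"
  by (rule polf_comp2[of A F s]) (auto intro: polf.base polf.const)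

lemma polf2_section2: "polf2 A F s \<Longrightarrow> b \<in> A \<Longrightarrow> pol1 A F (s b)"
  using polf_comp2[of A F s "{\<lambda>x. x}" "\<lambda>x. b" "\<lambda>x. x"] by (simp add: polf.base polf.const)

text \<open>f composed with e separates the same pair and has image f(U), which by minimality is no
  smaller than U.\<close>

lemma inj_if_separates:
  assumes f: "pol1 A F f" and xy: "x \<in> U" "y \<in> U" "(x, y) \<in> \<theta>" "(f x, f y) \<notin> \<delta>"
  shows "inj_on f U"
proof -
  have "card U \<le> card ((\<lambda>z. f (e z)) ` A)"
    by (rule min[OF polf_comp1[OF f e] xy(3)]) (use xy(4) e_on_U[OF xy(1)] e_on_U[OF xy(2)] in simp)
  also have "(\<lambda>z. f (e z)) ` A = f ` U" by auto
  finally have "card (f ` U) = card U" using card_image_le[OF finU, of f] by simp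
  then show ?thesis using eq_card_imp_inj_on[OF finU] by blast
qed

text \<open>The inverse of f on U is a power of f, hence a polynomial, and so preserves
  \<delta>.\<close>

lemma inj_reflects:
  assumes f: "pol1 A F f" "f ` U \<subseteq> U" "inj_on f U" and xy: "x \<in> U" "y \<in> U" "(f x, f y) \<in> \<delta>"
  shows "(x, y) \<in> \<delta>"
proof (rule exponent[OF finU])
  fix m assume "\<And>f x. f ` U \<subseteq> U \<Longrightarrow> inj_on f U \<Longrightarrow> x \<in> U \<Longrightarrow> (f ^^ m) x = x"
    and m: "\<And>(f :: 'a \<Rightarrow> 'a) x. (f ^^ (m - Suc 0)) (f x) = (f ^^ m) x"
  then have id: "\<And>x. x \<in> U \<Longrightarrow> (f ^^ m) x = x" using f by blast
  have "pol1 A F (\<lambda>x. (f ^^ (m - Suc 0)) x)" by (rule polf_funpow1[OF f(1) pol1_id])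
  from pol1_cong[OF this c\<delta> xy(3)] show ?thesis using m id xy by simp
qed

text \<open>The map s(-, a) separates a from b, so it permutes U; it also fixes a. Composing the
  first argument with its inverse makes a neutral on both sides and keeps the idempotence in the
  second argument, which is a pseudo-meet.\<close>

lemma no_absorbing:
  assumes s: "polf2 A F s" and sU: "\<And>w z. w \<in> U \<Longrightarrow> z \<in> U \<Longrightarrow> s w z \<in> U"
    and ab: "a \<in> U" "b \<in> U" "(a, b) \<in> \<theta>"
    and sa: "\<And>z. z \<in> U \<Longrightarrow> s a z = z"
    and idem: "\<And>w z. w \<in> U \<Longrightarrow> z \<in> U \<Longrightarrow> s w (s w z) = s w z"
    and sb: "(s b a, a) \<notin> \<delta>"
  shows False
proof (rule exponent[OF finU])
  let ?p = "\<lambda>w. s w a"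
  fix m assume mi: "\<And>f x. f ` U \<subseteq> U \<Longrightarrow> inj_on f U \<Longrightarrow> x \<in> U \<Longrightarrow> (f ^^ m) x = x"
    and m: "\<And>(f :: 'a \<Rightarrow> 'a) x. (f ^^ (m - Suc 0)) (f x) = (f ^^ m) x"
  have p: "pol1 A F ?p" using polf2_section1[OF s UA[OF ab(1)]] .
  have pU: "?p ` U \<subseteq> U" using sU ab by auto
  have "inj_on ?p U"
    by (rule inj_if_separates[OF p ab(1,2,3)]) (use sa[OF ab(1)] sb \<delta>_sym in auto)
  then have id: "(?p ^^ m) w = w" if "w \<in> U" for w using mi[OF pU] that by blast
  have pmU: "(?p ^^ (m - Suc 0)) w \<in> U" if "w \<in> U" for w
    using pU that by (intro funpow_closed) auto
  have pa: "(?p ^^ j) a = a" for j by (induction j) (auto simp: sa[OF ab(1)])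
  have comm: "?p ((?p ^^ (m - Suc 0)) w) = (?p ^^ (m - Suc 0)) (?p w)" for w
    using funpow_swap1[of ?p "m - Suc 0" w] by simp
  have "U = {a}"
  proof (rule no_pseudo_meet)
    show "polf2 A F (\<lambda>w z. s ((?p ^^ (m - Suc 0)) w) z)"
      by (rule polf_comp2[OF s polf_funpow1[OF p]]) (auto intro: polf.base)
    show "s ((?p ^^ (m - Suc 0)) w) a = w" if "w \<in> U" for w using comm[of w] m[of ?p w] id[OF that] by simp
    show "s ((?p ^^ (m - Suc 0)) a) z = z" if "z \<in> U" for z using pa sa that by simp
  qed (use sU pmU idem ab in auto)
  then show False using ab sb sa \<delta>_refl UA by auto
qed

text \<open>If s(a, -) permutes and s(b, -) collapses, then for the iterate r the map r(a, -) is the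
  identity and r(b, -) an idempotent collapse. Either \<open>no_absorbing\<close> applies to r, or
  to a modification of r with a and b exchanged.\<close>

lemma twin_on_trace:
  assumes s: "polf2 A F s" and sU: "\<And>w z. w \<in> U \<Longrightarrow> z \<in> U \<Longrightarrow> s w z \<in> U"
    and ab: "a \<in> U" "b \<in> U" "(a, b) \<in> \<theta>" and inj: "inj_on (s a) U"
  shows "inj_on (s b) U"
proof (rule ccontr)
  assume ninj: "\<not> inj_on (s b) U"
  show False
  proof (rule exponent[OF finU])
    fix m :: nat assume m0: "m > 0"
      and mm: "\<And>f x. f ` U \<subseteq> U \<Longrightarrow> x \<in> U \<Longrightarrow> (f ^^ m) ((f ^^ m) x) = (f ^^ m) x"
      and mi: "\<And>f x. f ` U \<subseteq> U \<Longrightarrow> inj_on f U \<Longrightarrow> x \<in> U \<Longrightarrow> (f ^^ m) x = x"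
      and m: "\<And>(f :: 'a \<Rightarrow> 'a) x. (f ^^ (m - Suc 0)) (f x) = (f ^^ m) x"
    have sw: "pol1 A F (s w)" "s w ` U \<subseteq> U" if "w \<in> U" for w
      using polf2_section2[OF s UA] sU that by auto
    define r where "r w z = (s w ^^ m) z" for w z
    have r: "polf2 A F r" unfolding r_def by (rule polf_funpow[OF s]) (auto intro: polf.base)
    have rU: "r w z \<in> U" if "w \<in> U" "z \<in> U" for w z
      unfolding r_def using sU that by (intro funpow_closed) auto
    have rr: "r w (r w z) = r w z" if "w \<in> U" "z \<in> U" for w z
      unfolding r_def using mm[OF sw(2)] that by blast
    have ra: "r a z = z" if "z \<in> U" for z unfolding r_def using mi[OF sw(2)] inj ab that by blast
    have rb: "(r b x, r b y) \<in> \<delta>" if "x \<in> U" "y \<in> U" "(x, y) \<in> \<theta>" for x y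
    proof -
      have "(s b x, s b y) \<in> \<delta>" using inj_if_separates[OF sw(1)] ninj that ab by blast
      moreover have "pol1 A F (\<lambda>x. (s b ^^ (m - Suc 0)) x)" using polf_funpow1[OF sw(1)[OF ab(2)] pol1_id] .
      ultimately have "((s b ^^ (m - Suc 0)) (s b x), (s b ^^ (m - Suc 0)) (s b y)) \<in> \<delta>"
        using pol1_cong[OF _ c\<delta>] by simp
      then show ?thesis by (simp add: r_def m)
    qed
    \<comment> \<open>Parameters equal modulo \<delta> would make r(a, -) and r(b, -) agree modulo
      \<delta>, though one is the identity and the other collapses u0 and u1.\<close>
    have ab\<delta>: "(a, b) \<notin> \<delta>"
    proof
      assume d: "(a, b) \<in> \<delta>"
      have "(r a z, r b z) \<in> \<delta>" if "z \<in> U" for z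
        using polf2_cong[OF r c\<delta> d] \<delta>_refl UA that by blast
      then have "(u0, r b u0) \<in> \<delta>" "(u1, r b u1) \<in> \<delta>" using ra u0 u1 by metis+
      then show False using rb[OF u0 u1 u\<theta>] u\<delta> \<delta>_sym \<delta>_trans by blast
    qed
    show False
    proof (cases "(r b a, a) \<in> \<delta>")
      case False
      then show False using no_absorbing[OF r rU ab ra rr] by blast
    next
      case True
      then have rbb: "(r b b, a) \<in> \<delta>"
        using rb ab \<theta>_sym \<delta>_trans by blast
      \<comment> \<open>Here r behaves like an implication on the trace; composing it with itself exchanges
        the roles of a and b and leads back to the first case.\<close>
      define q where "q w z = r (r w b) z" for w z
      have q: "polf2 A F q" unfolding q_def
        by (intro polf_comp2[OF r]) (use UA ab in \<open>auto intro: polf.base polf.const\<close>)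
      have qU: "q w z \<in> U" if "w \<in> U" "z \<in> U" for w z unfolding q_def using rU that ab by blast
      have qw: "pol1 A F (q w)" "q w ` U \<subseteq> U" if "w \<in> U" for w
        using polf2_section2[OF q UA] qU that by auto
      have qb: "(q b z, z) \<in> \<delta>" if "z \<in> U" for z
        using polf2_cong[OF r c\<delta> rbb \<delta>_refl[OF UA[OF that]]] ra that unfolding q_def by simp
      have "(q b u0, q b u1) \<notin> \<delta>" using qb[OF u0] qb[OF u1] u\<delta> \<delta>_sym \<delta>_trans by metis
      then have qinj: "inj_on (q b) U" using inj_if_separates[OF qw(1)[OF ab(2)] u0 u1 u\<theta>] by blast
      have qa: "q a z = r b z" if "z \<in> U" for z unfolding q_def using ra ab by simp
      \<comment> \<open>q(a, -) agrees on U with the idempotent r(b, -), hence so do all its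
        positive powers; this is where m > 0 matters.\<close>
      have qaj: "(q a ^^ Suc j) z = r b z" if "z \<in> U" for j z
        by (induction j) (use that ab qa rr rU in auto)
      define p where "p w z = (q w ^^ m) z" for w z
      have p: "polf2 A F p" unfolding p_def by (rule polf_funpow[OF q]) (auto intro: polf.base)
      have pU: "p w z \<in> U" if "w \<in> U" "z \<in> U" for w z
        unfolding p_def using qU that by (intro funpow_closed) auto
      have pp: "p w (p w z) = p w z" if "w \<in> U" "z \<in> U" for w z
        unfolding p_def using mm[OF qw(2)] that by blast
      have pb: "p b z = z" if "z \<in> U" for z
        unfolding p_def using mi[OF qw(2)] qinj ab that by blast
      have "p a b = r b b" unfolding p_def using qaj[OF ab(2), of "m - Suc 0"] m0 by simp
      then have "(p a b, b) \<notin> \<delta>" using rbb ab\<delta> \<delta>_sym \<delta>_trans by metis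
      then show False using no_absorbing[OF p pU ab(2,1) \<theta>_sym[OF ab(3)] pb pp] by blast
    qed
  qed
qed

text \<open>Being of the same kind is an equivalence on parameters, so by \<open>generation\<close>
  it suffices to treat pairs in \<delta> and the images (g u0, g u1). The latter reduce to the
  parameters u0, u1 in U for s(g w, z).\<close>

lemma twin:
  assumes s: "polf2 A F s" and sU: "\<And>w z. w \<in> A \<Longrightarrow> z \<in> U \<Longrightarrow> s w z \<in> U"
    and xy: "(x, y) \<in> \<theta>"
  shows "inj_on (s x) U \<longleftrightarrow> inj_on (s y) U"
proof -
  let ?Q = "{(x, y). x \<in> A \<and> y \<in> A \<and> (inj_on (s x) U \<longleftrightarrow> inj_on (s y) U)}"
  have "\<theta> \<subseteq> ?Q"
  proof (rule generation[OF u\<theta> u\<delta>])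
    show "equiv A ?Q" by (rule equivI) (auto simp: refl_on_def sym_def trans_def)
    have *: "inj_on (s y) U" if "(x, y) \<in> \<delta>" "inj_on (s x) U" for x y
    proof (rule inj_if_separates[OF _ u0 u1 u\<theta>])
      have A: "x \<in> A" "y \<in> A" using \<delta>A that by auto
      then show "pol1 A F (s y)" using polf2_section2[OF s] by blast
      have d: "(s x z, s y z) \<in> \<delta>" if "z \<in> U" for z
        using polf2_cong[OF s c\<delta> \<open>(x, y) \<in> \<delta>\<close> \<delta>_refl[OF UA[OF that]]] .
      have "(s x u0, s x u1) \<notin> \<delta>"
        using inj_reflects[OF polf2_section2[OF s A(1)] _ that(2) u0 u1] u\<delta> sU A by blast
      then show "(s y u0, s y u1) \<notin> \<delta>" using d[OF u0] d[OF u1] \<delta>_sym \<delta>_trans by blast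
    qed
    then show "\<delta> \<subseteq> ?Q" using \<delta>A \<delta>_sym by blast
    fix g assume g: "pol1 A F g"
    have sg: "polf2 A F (\<lambda>w z. s (g w) z)"
      by (rule polf_comp2[OF s polf_comp1[OF g]]) (auto intro: polf.base)
    have gA: "g w \<in> A" if "w \<in> U" for w using pol1_closed[OF g alg UA[OF that]] .
    show "(g u0, g u1) \<in> ?Q"
      using twin_on_trace[OF sg _ u0 u1 u\<theta>] twin_on_trace[OF sg _ u1 u0 \<theta>_sym[OF u\<theta>]] sU gA u0 u1
      by blast
  qed
  then show ?thesis using xy by auto
qed

end


section \<open>Centrality from the absence of twins\<close>

context minimal_set
begin

lemma list_update_\<theta>:
  assumes "\<And>j. j < n \<Longrightarrow> (as ! j, bs ! j) \<in> \<theta>" "length as = n" "i < n" "(x, bs ! i) \<in> \<theta>" "j < n"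
  shows "(as[i := x] ! j, bs ! j) \<in> \<theta>"
  using assms by (cases "i = j") auto

lemma twin_list:
  assumes f: "polfp A F n f" and fU: "\<And>z zs. z \<in> U \<Longrightarrow> length zs = n \<Longrightarrow> set zs \<subseteq> A \<Longrightarrow> f z zs \<in> U"
    and l: "length as = n" "length bs = n" and ab: "\<And>j. j < n \<Longrightarrow> (as ! j, bs ! j) \<in> \<theta>"
  shows "inj_on (\<lambda>z. f z as) U \<longleftrightarrow> inj_on (\<lambda>z. f z bs) U"
proof (rule hybrid_path[OF l, of "\<lambda>as bs. inj_on (\<lambda>z. f z as) U \<longleftrightarrow> inj_on (\<lambda>z. f z bs) U"])
  fix zs i assume z: "length zs = n" "i < n"
    and zj: "\<And>j. j < n \<Longrightarrow> zs ! j = as ! j \<or> zs ! j = bs ! j"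
  have zA: "zs ! j \<in> A" if "j < n" for j using zj[OF that] ab[OF that] \<theta>A by metis
  then have zA': "set zs \<subseteq> A" using z by (auto simp: in_set_conv_nth)
  have "polf2 A F (\<lambda>w z. f z (zs[i := w]))"
  proof (rule polf_compp[OF f])
    fix j assume j: "j < n"
    show "polf A F {fst, snd} (\<lambda>x. zs[i := fst x] ! j)"
      by (rule polf_update[where n = n]) (use j z zA in \<open>auto intro: polf.base polf.const\<close>)
  qed (auto intro: polf.base)
  then show "inj_on (\<lambda>z. f z (zs[i := as ! i])) U \<longleftrightarrow> inj_on (\<lambda>z. f z (zs[i := bs ! i])) U"
  proof (rule twin[OF _ _ ab[OF z(2)]])
    show "f z (zs[i := w]) \<in> U" if "w \<in> A" "z \<in> U" for w z
      using that z zA' by (intro fU) (auto dest!: subsetD[OF set_update_subset_insert])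
  qed
qed auto

lemma dependence:
  assumes f: "pol1 A F f" and xy: "(x, y) \<in> \<theta>" "(f x, f y) \<notin> \<delta>"
  obtains g where "pol1 A F g" "(g u0, x) \<in> \<theta>" "inj_on (\<lambda>z. f (g z)) U"
proof -
  obtain g where g: "pol1 A F g" "(g u0, x) \<in> \<theta>" "(f (g u0), f (g u1)) \<notin> \<delta>"
    using separating_translation[OF u\<theta> u\<delta> f xy] by metis
  then show ?thesis
    using that inj_if_separates[OF polf_comp1[OF f g(1)] u0 u1 u\<theta>] by blast
qed

text \<open>On the way from cs to ds the value of f leaves its \<delta>-class at some single
  coordinate, to which \<open>dependence\<close> applies.\<close>

lemma dependence_list:
  assumes f: "polf A F (projs n) f" and l: "length cs = n" "length ds = n"
    and cd: "\<And>j. j < n \<Longrightarrow> (cs ! j, ds ! j) \<in> \<theta>" and fcd: "(f cs, f ds) \<notin> \<delta>"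
  obtains zs i g where "length zs = n" "i < n" "\<And>j. j < n \<Longrightarrow> (zs ! j, cs ! j) \<in> \<theta>"
    "pol1 A F g" "(g u0, cs ! i) \<in> \<theta>" "inj_on (\<lambda>z. f (zs[i := g z])) U"
proof (rule ccontr)
  assume no: "\<not> thesis"
  let ?Q = "\<lambda>us vs. us = vs \<or> (f us, f vs) \<in> \<delta>"
  have "?Q cs ds"
  proof (rule hybrid_path[OF l, of ?Q])
    fix zs i assume z: "length zs = n" "i < n"
      and zj: "\<And>j. j < n \<Longrightarrow> zs ! j = cs ! j \<or> zs ! j = ds ! j"
    have z\<theta>: "(zs ! j, cs ! j) \<in> \<theta>" if "j < n" for j
      using zj[OF that] cd[OF that] \<theta>_refl \<theta>_sym \<theta>A by metis
    have pol: "pol1 A F (\<lambda>x. f (zs[i := x]))"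
    proof (rule polf_compl[OF f])
      fix j assume j: "j < n"
      show "pol1 A F (\<lambda>x. zs[i := x] ! j)"
        by (rule polf_update[where n = n])
          (use j z z\<theta> \<theta>A in \<open>auto intro: polf.base polf.const\<close>)
    qed
    have "(f (zs[i := cs ! i]), f (zs[i := ds ! i])) \<in> \<delta>"
    proof (rule ccontr)
      assume "(f (zs[i := cs ! i]), f (zs[i := ds ! i])) \<notin> \<delta>"
      from dependence[OF pol cd[OF z(2)] this] show False using no that z z\<theta> by metis
    qed
    then show "?Q (zs[i := cs ! i]) (zs[i := ds ! i])" ..
  qed (use \<delta>_trans in blast)+
  moreover have "set cs \<subseteq> A" using l cd \<theta>A by (metis in_set_conv_nth subsetI)
  then have "f cs \<in> A" using l by (intro polf_closed[OF f alg]) auto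
  ultimately show False using fcd \<delta>_refl by auto
qed

text \<open>Undoing the permutation s(-, u0) on values makes u0 right neutral. The resulting r(u0,
  -) fixes u0, so undoing it in the second argument gives left neutrality without losing the right
  one.\<close>

lemma pseudo_addition:
  assumes s: "polf2 A F s" and sU: "\<And>w z. w \<in> U \<Longrightarrow> z \<in> U \<Longrightarrow> s w z \<in> U"
    and inj: "inj_on (\<lambda>w. s w u0) U" "inj_on (s u0) U"
  obtains ad where "polf2 A F ad" "\<And>w z. w \<in> U \<Longrightarrow> z \<in> U \<Longrightarrow> ad w z \<in> U"
    "\<And>w. w \<in> U \<Longrightarrow> ad w u0 = w" "\<And>z. z \<in> U \<Longrightarrow> ad u0 z = z"
proof (rule exponent[OF finU])
  fix m assume mi: "\<And>f x. f ` U \<subseteq> U \<Longrightarrow> inj_on f U \<Longrightarrow> x \<in> U \<Longrightarrow> (f ^^ m) x = x"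
    and m: "\<And>(f :: 'a \<Rightarrow> 'a) x. (f ^^ (m - Suc 0)) (f x) = (f ^^ m) x"
  let ?b = "\<lambda>w. s w u0"
  define r where "r w z = (?b ^^ (m - Suc 0)) (s w z)" for w z
  have bU: "?b ` U \<subseteq> U" using sU u0 by auto
  have b: "pol1 A F ?b" using polf2_section1[OF s UA[OF u0]] .
  have r: "polf2 A F r" unfolding r_def by (rule polf_funpow1[OF b s])
  have rU: "r w z \<in> U" if "w \<in> U" "z \<in> U" for w z
    unfolding r_def using bU sU[OF that] by (intro funpow_closed) auto
  have r0: "r w u0 = w" if "w \<in> U" for w
    unfolding r_def using m[of ?b w] mi[OF bU inj(1) that] by simp
  have rinj: "inj_on (r u0) U"
  proof -
    have "inj_on (?b ^^ (m - Suc 0)) (s u0 ` U)"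
      by (rule inj_on_subset[OF inj_on_funpow_closed[OF inj(1) bU]]) (use sU u0 in auto)
    from comp_inj_on[OF inj(2) this] show ?thesis by (simp add: comp_def r_def[abs_def])
  qed
  have ru: "r u0 ` U \<subseteq> U" using rU u0 by auto
  have r0j: "(r u0 ^^ j) u0 = u0" for j by (induction j) (auto simp: r0[OF u0])
  define ad where "ad w z = r w ((r u0 ^^ (m - Suc 0)) z)" for w z
  show thesis
  proof (rule that[of ad])
    show "polf2 A F ad" unfolding ad_def
      by (rule polf_comp2[OF r _ polf_funpow1[OF polf2_section2[OF r UA[OF u0]]]])
        (auto intro: polf.base)
    show "ad w z \<in> U" if "w \<in> U" "z \<in> U" for w z
    proof -
      have "(r u0 ^^ (m - Suc 0)) z \<in> U" using ru that by (intro funpow_closed) auto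
      then show ?thesis unfolding ad_def using rU that by blast
    qed
    show "ad w u0 = w" if "w \<in> U" for w unfolding ad_def using r0j r0 that by simp
    show "ad u0 z = z" if "z \<in> U" for z
      unfolding ad_def using funpow_swap1[of "r u0" "m - Suc 0" z] m[of "r u0" z] mi[OF ru rinj that] by simp
  qed
qed

text \<open>As ad(u0, -) is the identity, \<open>twin_on_trace\<close> makes ad(w, -) a permutation
  of U for w in the class of u0. Its inverse is b(w, -), and ad(w, u0) = w turns into b(w, w) =
  u0.\<close>

lemma pseudo_subtraction:
  assumes ad: "polf2 A F ad" and adU: "\<And>w z. w \<in> U \<Longrightarrow> z \<in> U \<Longrightarrow> ad w z \<in> U"
    and r: "\<And>w. w \<in> U \<Longrightarrow> ad w u0 = w" and l: "\<And>z. z \<in> U \<Longrightarrow> ad u0 z = z"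
  obtains b where "polf2 A F b" "\<And>w z. w \<in> U \<Longrightarrow> z \<in> U \<Longrightarrow> b w z \<in> U"
    "\<And>w. w \<in> U \<Longrightarrow> (w, u0) \<in> \<theta> \<Longrightarrow> b w w = u0" "\<And>w. w \<in> U \<Longrightarrow> (w, u0) \<in> \<theta> \<Longrightarrow> inj_on (b w) U"
proof (rule exponent[OF finU])
  fix m assume mi: "\<And>f x. f ` U \<subseteq> U \<Longrightarrow> inj_on f U \<Longrightarrow> x \<in> U \<Longrightarrow> (f ^^ m) x = x"
    and m: "\<And>(f :: 'a \<Rightarrow> 'a) x. (f ^^ (m - Suc 0)) (f x) = (f ^^ m) x"
  have "inj_on (ad u0) U" using l by (auto intro: inj_onI)
  then have inj: "inj_on (ad w) U" if "w \<in> U" "(w, u0) \<in> \<theta>" for w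
    using twin_on_trace[OF ad adU u0 that(1) \<theta>_sym[OF that(2)]] by blast
  have aU: "ad w ` U \<subseteq> U" if "w \<in> U" for w using adU that by auto
  show thesis
  proof (rule that[of "\<lambda>w z. (ad w ^^ (m - Suc 0)) z"])
    show "polf2 A F (\<lambda>w z. (ad w ^^ (m - Suc 0)) z)"
      by (rule polf_funpow[OF ad]) (auto intro: polf.base)
    show "(ad w ^^ (m - Suc 0)) z \<in> U" if "w \<in> U" "z \<in> U" for w z
      using adU that by (intro funpow_closed) auto
    show "(ad w ^^ (m - Suc 0)) w = u0" if "w \<in> U" "(w, u0) \<in> \<theta>" for w
      using m[of "ad w" u0] r[OF that(1)] mi[OF aU inj u0] that by simp
    show "inj_on (\<lambda>z. (ad w ^^ (m - Suc 0)) z) U" if "w \<in> U" "(w, u0) \<in> \<theta>" for w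
      using inj_on_funpow_closed[OF inj aU] that by simp
  qed
qed

lemma set_\<theta>: "length zs = n \<Longrightarrow> (\<And>j. j < n \<Longrightarrow> (zs ! j, cs ! j) \<in> \<theta>) \<Longrightarrow> set zs \<subseteq> A"
  using \<theta>A by (metis in_set_conv_nth subsetI)

text \<open>A failure of the term condition makes t depend on its parameters at w = y, and on w at
  some choice of parameters. Absence of twins moves both dependences to a common place.\<close>

lemma failure_dependence:
  assumes t: "polfp A F n t" and tU: "\<And>w zs. w \<in> A \<Longrightarrow> length zs = n \<Longrightarrow> set zs \<subseteq> A \<Longrightarrow> t w zs \<in> U"
    and xy: "(x, y) \<in> \<theta>" and l: "length cs = n" "length ds = n"
    and cd: "\<And>j. j < n \<Longrightarrow> (cs ! j, ds ! j) \<in> \<theta>"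
    and tx: "(t x cs, t x ds) \<in> \<delta>" and ty: "(t y cs, t y ds) \<notin> \<delta>"
  obtains s where "polf2 A F s" "\<And>w z. w \<in> U \<Longrightarrow> z \<in> U \<Longrightarrow> s w z \<in> U"
    "inj_on (\<lambda>w. s w u0) U" "inj_on (s u0) U"
proof -
  have xA: "x \<in> A" "y \<in> A" using \<theta>A[OF xy] by auto
  obtain zs i h where z: "length zs = n" "i < n" and z\<theta>: "\<And>j. j < n \<Longrightarrow> (zs ! j, cs ! j) \<in> \<theta>"
    and h: "pol1 A F h" "(h u0, cs ! i) \<in> \<theta>" "inj_on (\<lambda>z. t y (zs[i := h z])) U"
    using dependence_list[OF polfp_section[OF t xA(2)] l cd ty] by metis
  have zA: "set zs \<subseteq> A" using set_\<theta>[OF z(1) z\<theta>] .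
  \<comment> \<open>If x and y gave \<delta>-related values at both cs and ds, the relation at x
    would carry over to y; so one of the two lists shows dependence on w.\<close>
  obtain zs' where z': "length zs' = n" "\<And>j. j < n \<Longrightarrow> (zs' ! j, cs ! j) \<in> \<theta>" "(t x zs', t y zs') \<notin> \<delta>"
  proof (cases "(t x cs, t y cs) \<in> \<delta>")
    case True
    then have "(t x ds, t y ds) \<notin> \<delta>" using tx ty \<delta>_sym \<delta>_trans by metis
    then show thesis using that l cd \<theta>_sym by metis
  next
    case False
    then show thesis using that l cd \<theta>_refl \<theta>A by metis
  qed
  have z'A: "set zs' \<subseteq> A" using set_\<theta>[OF z'(1,2)] .
  have "pol1 A F (\<lambda>w. t w zs')"
    by (rule polf_compp[OF t pol1_id]) (use z' \<theta>A in \<open>auto intro: polf.const\<close>)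
  from dependence[OF this xy z'(3)] obtain g
    where g: "pol1 A F g" "(g u0, x) \<in> \<theta>" "inj_on (\<lambda>w. t (g w) zs') U" by metis
  have gA: "g w \<in> A" if "w \<in> A" for w using pol1_closed[OF g(1) alg that] .
  have upd: "set (zs[i := h z]) \<subseteq> A" if "z \<in> A" for z
    using zA pol1_closed[OF h(1) alg that] by (auto dest!: subsetD[OF set_update_subset_insert])
  have tg: "polfp A F n (\<lambda>w zs. t (g w) zs)"
    by (rule polf_compp[OF t polf_comp1[OF g(1)]]) (auto intro: polf.base)
  have th: "polf2 A F (\<lambda>w z. t w (zs[i := h z]))"
    using polfp_update[OF t pol1_id h(1) z(1) zA z(2)] by simp
  show thesis
  proof (rule that[of "\<lambda>w z. t (g w) (zs[i := h z])"])
    show "polf2 A F (\<lambda>w z. t (g w) (zs[i := h z]))"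
      by (rule polfp_update[OF t g(1) h(1) z(1) zA z(2)])
    show "t (g w) (zs[i := h z]) \<in> U" if "w \<in> U" "z \<in> U" for w z
      using that gA upd UA z by (intro tU) auto
    have "inj_on (\<lambda>w. t (g w) zs') U \<longleftrightarrow> inj_on (\<lambda>w. t (g w) (zs[i := h u0])) U"
    proof (rule twin_list[OF tg])
      show "t (g w) zs \<in> U" if "w \<in> U" "length zs = n" "set zs \<subseteq> A" for w zs
        using tU gA UA that by blast
      show "(zs' ! j, zs[i := h u0] ! j) \<in> \<theta>" if "j < n" for j
        using \<theta>_trans[OF z'(2)[OF that] \<theta>_sym[OF list_update_\<theta>[OF z\<theta> z(1,2) h(2) that]]] .
    qed (use z z' in auto)
    then show "inj_on (\<lambda>w. t (g w) (zs[i := h u0])) U" using g by blast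
    have "inj_on (\<lambda>z. t y (zs[i := h z])) U \<longleftrightarrow> inj_on (\<lambda>z. t (g u0) (zs[i := h z])) U"
    proof (rule twin[OF th])
      show "t w (zs[i := h z]) \<in> U" if "w \<in> A" "z \<in> U" for w z
        using that upd UA z by (intro tU) auto
      show "(y, g u0) \<in> \<theta>" using g(2) xy \<theta>_sym \<theta>_trans by blast
    qed
    then show "inj_on (\<lambda>z. t (g u0) (zs[i := h z])) U" using h by blast
  qed
qed

text \<open>With a subtraction b, the polynomial b(t(x, zs), t(w, zs)) is constant in zs for w = x,
  but still depends on zs for w = y, so that x and y give twins of different kinds.\<close>
lemma term_condition_single:
  assumes t: "polfp A F n t"
    and xy: "(x, y) \<in> \<theta>" and l: "length cs = n" "length ds = n"
    and cd: "\<And>j. j < n \<Longrightarrow> (cs ! j, ds ! j) \<in> \<theta>"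
    and tx: "(t x cs, t x ds) \<in> \<delta>"
  shows "(t y cs, t y ds) \<in> \<delta>"
proof (rule ccontr)
  assume ty: "(t y cs, t y ds) \<notin> \<delta>"
  have xA: "x \<in> A" "y \<in> A" using \<theta>A[OF xy] by auto
  have csA: "set cs \<subseteq> A" using set_\<theta>[OF l(1) cd] .
  have eu: "e u0 = u0" "e u1 = u1" using e_on_U u0 u1 by blast+
  have "(t y cs, t y ds) \<in> \<theta>" using polfp_cong[OF t c\<theta> \<theta>_refl[OF xA(2)] cd] .
  \<comment> \<open>Here the failing pair generates and (u0, u1) is the target, so k carries the
    failure into U with a value \<theta>-related to u0, where the subtraction works.\<close>
  then obtain k where k: "pol1 A F k" "(k (t y cs), u0) \<in> \<theta>" "(e (k (t y cs)), e (k (t y ds))) \<notin> \<delta>"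
    using separating_translation[OF _ ty e u\<theta>] u\<delta> unfolding eu by metis
  define p where "p w zs = e (k (t w zs))" for w zs
  have p: "polfp A F n p" unfolding p_def by (rule polf_comp1[OF e polf_comp1[OF k(1) t]])
  have pU: "p w zs \<in> U" if "w \<in> A" "length zs = n" "set zs \<subseteq> A" for w zs
    unfolding p_def using pol1_closed[OF k(1) alg polfp_closed[OF t alg that]] by blast
  have px: "(p x cs, p x ds) \<in> \<delta>"
    unfolding p_def by (intro pol1_cong[OF e c\<delta>] pol1_cong[OF k(1) c\<delta>] tx)
  have py: "(p y cs, p y ds) \<notin> \<delta>" using k(3) unfolding p_def .
  have p\<theta>: "(p w zs, u0) \<in> \<theta>" if "(w, y) \<in> \<theta>" "\<And>j. j < n \<Longrightarrow> (zs ! j, cs ! j) \<in> \<theta>" for w zs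
  proof -
    have "(p w zs, p y cs) \<in> \<theta>" by (rule polfp_cong[OF p c\<theta> that])
    moreover have "(p y cs, u0) \<in> \<theta>" using pol1_cong[OF e c\<theta> k(2)] unfolding eu p_def .
    ultimately show ?thesis by (rule \<theta>_trans)
  qed
  obtain s where s: "polf2 A F s" "\<And>w z. w \<in> U \<Longrightarrow> z \<in> U \<Longrightarrow> s w z \<in> U"
    "inj_on (\<lambda>w. s w u0) U" "inj_on (s u0) U"
    by (rule failure_dependence[OF p pU xy l cd px py]) (assumption+, rule that, assumption+)
  obtain ad
    where ad: "polf2 A F ad" "\<And>w z. w \<in> U \<Longrightarrow> z \<in> U \<Longrightarrow> ad w z \<in> U"
      "\<And>w. w \<in> U \<Longrightarrow> ad w u0 = w" "\<And>z. z \<in> U \<Longrightarrow> ad u0 z = z"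
    by (rule pseudo_addition[OF s]) (assumption+, rule that, assumption+)
  obtain b
    where b: "polf2 A F b" and bU: "\<And>w z. w \<in> U \<Longrightarrow> z \<in> U \<Longrightarrow> b w z \<in> U"
      and bb: "\<And>w. w \<in> U \<Longrightarrow> (w, u0) \<in> \<theta> \<Longrightarrow> b w w = u0"
      and binj: "\<And>w. w \<in> U \<Longrightarrow> (w, u0) \<in> \<theta> \<Longrightarrow> inj_on (b w) U"
    by (rule pseudo_subtraction[OF ad]) (assumption+, rule that, assumption+)
  define r where "r w zs = b (p x zs) (p w zs)" for w zs
  have r: "polfp A F n r"
    unfolding r_def by (rule polf_comp2[OF b _ p], rule polf_compp[OF p])
      (use xA in \<open>auto intro: polf.base polf.const\<close>)
  have rU: "r w zs \<in> U" if "w \<in> A" "length zs = n" "set zs \<subseteq> A" for w zs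
    unfolding r_def using that xA(1) by (intro bU pU)
  have rx: "r x zs = u0" if "length zs = n" "\<And>j. j < n \<Longrightarrow> (zs ! j, cs ! j) \<in> \<theta>" for zs
    unfolding r_def using bb[OF pU[OF xA(1) that(1) set_\<theta>[OF that]] p\<theta>[OF xy that(2)]] .
  have c\<theta>': "(cs ! j, cs ! j) \<in> \<theta>" "(ds ! j, cs ! j) \<in> \<theta>" if "j < n" for j
    using cd[OF that] \<theta>_sym \<theta>_trans by blast+
  have dsA: "set ds \<subseteq> A" using set_\<theta>[OF l(2) c\<theta>'(2)] .
  \<comment> \<open>At cs and ds, r(y, -) equals b(w, p(y, -)) modulo \<delta> with w = p(x, cs),
    and the injective map b(w, -) reflects \<delta>.\<close>
  have ry: "(r y cs, r y ds) \<notin> \<delta>"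
  proof
    let ?w = "p x cs"
    have pU': "?w \<in> U" "p y cs \<in> U" "p y ds \<in> U" using xA l csA dsA by (auto intro: pU)
    assume "(r y cs, r y ds) \<in> \<delta>"
    moreover have "(r y ds, b ?w (p y ds)) \<in> \<delta>"
      unfolding r_def by (rule polf2_cong[OF b c\<delta> \<delta>_sym[OF px] \<delta>_refl[OF UA[OF pU'(3)]]])
    ultimately have "(b ?w (p y cs), b ?w (p y ds)) \<in> \<delta>" unfolding r_def by (rule \<delta>_trans)
    then have "(p y cs, p y ds) \<in> \<delta>"
      using inj_reflects[OF polf2_section2[OF b UA[OF pU'(1)]] _ binj[OF pU'(1) p\<theta>[OF xy c\<theta>'(1)]] pU'(2,3)]
        bU pU'(1) by blast
    then show False using py by blast
  qed
  obtain zs i h where z: "length zs = n" "i < n" and z\<theta>: "\<And>j. j < n \<Longrightarrow> (zs ! j, cs ! j) \<in> \<theta>"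
    and h: "pol1 A F h" "(h u0, cs ! i) \<in> \<theta>" "inj_on (\<lambda>z. r y (zs[i := h z])) U"
    using dependence_list[OF polfp_section[OF r xA(2)] l cd ry] by metis
  have zA: "set zs \<subseteq> A" using set_\<theta>[OF z(1) z\<theta>] .
  \<comment> \<open>The section at y is injective in z, while the one at x takes the value u0 at
    both u0 and u1.\<close>
  have "inj_on (\<lambda>z. r x (zs[i := h z])) U \<longleftrightarrow> inj_on (\<lambda>z. r y (zs[i := h z])) U"
  proof (rule twin[OF _ _ xy])
    show "polf2 A F (\<lambda>w z. r w (zs[i := h z]))"
      using polfp_update[OF r pol1_id h(1) z(1) zA z(2)] by simp
    show "r w (zs[i := h z]) \<in> U" if "w \<in> A" "z \<in> U" for w z
      using that zA z pol1_closed[OF h(1) alg UA]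
      by (intro rU) (auto dest!: subsetD[OF set_update_subset_insert])
  qed
  moreover have "r x (zs[i := h u0]) = u0"
    by (rule rx) (use z list_update_\<theta>[OF z\<theta> z(1,2) h(2)] in auto)
  moreover have "(h u1, cs ! i) \<in> \<theta>" using pol1_cong[OF h(1) c\<theta> u\<theta>] h(2) \<theta>_sym \<theta>_trans by blast
  then have "r x (zs[i := h u1]) = u0"
    by (intro rx) (use z list_update_\<theta>[OF z\<theta> z(1,2)] in auto)
  ultimately have "u0 = u1" using h(3) inj_onD[of "\<lambda>z. r x (zs[i := h z])" U u0 u1] u0 u1 by simp
  then show False using u\<delta> \<delta>_refl UA u0 by blast
qed

lemma centralizes_\<theta>_\<delta>: "centralizes F \<theta> \<theta> \<delta>"
  unfolding centralizes_def
proof (intro allI impI, elim conjE)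
  fix m n t a b c d
  assume t: "clo {} F (m + n) t" and l: "length a = m" "length b = m" "length c = n" "length d = n"
    and ab: "list_all2 (\<lambda>x y. (x, y) \<in> \<theta>) a b" and cd: "list_all2 (\<lambda>x y. (x, y) \<in> \<theta>) c d"
    and eq: "(t (a @ c), t (a @ d)) \<in> \<delta>"
  have "clo A F (m + n) t" using t by (induction rule: clo.induct) (auto intro: clo.intros)
  then have pt: "polf A F (projs (m + n)) t" by (simp add: clo_iff_polf)
  \<comment> \<open>As an implication Q is reflexive and transitive, so the first block may be
    changed one coordinate at a time, each by the single-variable case.\<close>
  let ?Q = "\<lambda>us vs. (t (us @ c), t (us @ d)) \<in> \<delta> \<longrightarrow> (t (vs @ c), t (vs @ d)) \<in> \<delta>"
  have "?Q a b"
  proof (rule hybrid_path[OF l(1,2), of ?Q])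
    fix zs i assume z: "length zs = m" "i < m"
      and zj: "\<And>j. j < m \<Longrightarrow> zs ! j = a ! j \<or> zs ! j = b ! j"
    have ab': "(a ! j, b ! j) \<in> \<theta>" if "j < m" for j using ab that l by (simp add: list_all2_conv_all_nth)
    have zA: "zs ! j \<in> A" if "j < m" for j using zj[OF that] ab'[OF that] \<theta>A by metis
    have "polfp A F n (\<lambda>x ws. t (zs[i := x] @ ws))" (is "polf A F ?G _")
    proof (rule polf_compl[OF pt])
      fix j assume j: "j < m + n"
      show "polf A F ?G (\<lambda>z. (zs[i := fst z] @ snd z) ! j)"
      proof (cases "j < m")
        case True
        then have "polf A F ?G (\<lambda>z. zs[i := fst z] ! j)"
          by (intro polf_update[where n = m]) (use z zA in \<open>auto intro: polf.base polf.const\<close>)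
        then show ?thesis using True z by (simp add: nth_append)
      next
        case False
        have "polf A F ?G (\<lambda>z. snd z ! (j - m))"
          by (rule polf.base) (use False j in \<open>auto intro!: rev_image_eqI\<close>)
        then show ?thesis using False z by (simp add: nth_append)
      qed
    qed
    from term_condition_single[OF this ab'[OF z(2)] l(3,4)]
    show "?Q (zs[i := a ! i]) (zs[i := b ! i])" using cd l by (simp add: list_all2_conv_all_nth)
  qed auto
  then show "(t (b @ c), t (b @ d)) \<in> \<delta>" using eq by blast
qed

end


section \<open>Strong connectivity implies solvability\<close>

text \<open>In Tr(f) every edge into a starts at a, so strong connectivity leaves a as the only
  vertex.\<close>

lemma no_pseudo_meet_if_strongly_connected:
  assumes sc: "\<And>n p. poly_op U (induced_ops A F U) n p \<Longrightarrow> idempotent U n p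
      \<Longrightarrow> strongly_connected U (tr_edges U n p)"
    and f: "polf2 A F f" and fU: "\<And>w z. w \<in> U \<Longrightarrow> z \<in> U \<Longrightarrow> f w z \<in> U"
    and a: "a \<in> U" and r: "\<And>w. w \<in> U \<Longrightarrow> f w a = w" and l: "\<And>z. z \<in> U \<Longrightarrow> f a z = z"
    and ff: "\<And>w z. w \<in> U \<Longrightarrow> z \<in> U \<Longrightarrow> f w (f w z) = f w z"
  shows "U = {a}"
proof -
  let ?p = "\<lambda>xs. f (xs ! 0) (xs ! 1)"
  have "polf A F (projs 2) ?p"
    by (rule polf_comp2[OF f]) (auto intro: polf.base)
  then have "(2, ?p) \<in> induced_ops A F U"
    using fU by (auto simp: induced_ops_def clo_iff_polf subset_code(1))
  then have "clo U (induced_ops A F U) 2 (\<lambda>xs. ?p (map (\<lambda>h. h xs) [\<lambda>xs. xs ! 0, \<lambda>xs. xs ! 1]))"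
    by (rule clo.comp) (auto intro: clo.proj)
  then have "clo U (induced_ops A F U) 2 ?p" by simp
  moreover have "idempotent U 2 ?p"
    unfolding idempotent_def
  proof
    \<comment> \<open>f(x, x) = f(x, f(x, a)) = f(x, a) = x.\<close>
    show "?p (replicate 2 x) = x" if "x \<in> U" for x
      using ff[OF that a] r[OF that] by (simp add: numeral_2_eq_2)
  qed
  ultimately have sc: "strongly_connected U (tr_edges U 2 ?p)" by (rule sc)
  have in_edge: "c = a" if e: "(c, a) \<in> tr_edges U 2 ?p" for c
  proof -
    obtain d i where cd: "c \<in> U" "d \<in> U" and i: "i < 2" "a = ?p ((replicate 2 c)[i := d])"
      using e unfolding tr_edges_def by blast
    \<comment> \<open>If a = f(d, c), then d = f(d, a) = f(d, f(d, c)) = a, and hence c = f(a, c) =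
      a. If a = f(c, d), then c = f(c, a) = f(c, f(c, d)) = a.\<close>
    from i consider "a = f d c" | "a = f c d" by (auto simp: less_Suc_eq numeral_2_eq_2)
    then show ?thesis
    proof cases
      case 1
      then have "d = a" using ff[OF cd(2,1)] r[OF cd(2)] by metis
      then show ?thesis using 1 l[OF cd(1)] by metis
    next
      case 2
      then show ?thesis using ff[OF cd] r[OF cd(1)] by metis
    qed
  qed
  have "u = a" if "(u, a) \<in> (tr_edges U 2 ?p)\<^sup>*" for u
    using that by (induction rule: converse_rtrancl_induct) (use in_edge in blast)+
  then show ?thesis using sc a unfolding strongly_connected_def by blast
qed

section \<open>Stabilization of the derived series and choice of a prime quotient\<close>

lemma derived_stabilizes:
  assumes "is_algebra A F" "finite A"
  obtains k where "derived A F (Suc k) = derived A F k"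
proof (rule ccontr)
  assume no: "\<not> thesis"
  have sub: "derived A F k \<subseteq> A \<times> A" for k
    using derived_congruence[OF assms(1), of k] by (auto simp: congruence_def equiv_def)
  have fin: "finite (derived A F k)" for k using finite_subset[OF sub] assms(2) by blast
  have "derived A F (Suc k) \<subset> derived A F k" for k
    using commutator_congruence(3)[OF assms(1) derived_congruence[OF assms(1)], of k] no that by auto
  then have dec: "card (derived A F (Suc k)) < card (derived A F k)" for k
    using psubset_card_mono[OF fin] by blast
  have "card (derived A F k) + k \<le> card (derived A F 0)" for k
  proof (induction k)
    case (Suc k)
    then show ?case using dec[of k] by linarith
  qed simp
  from this[of "Suc (card (derived A F 0))"] show False by simp
qed

lemma congruence_Id_on: "is_algebra A F \<Longrightarrow> congruence A F (Id_on A)"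
  by (rule congruenceI) (auto intro: pol1_closed intro!: equivI simp: refl_on_def sym_def trans_def)

lemma maximal_congruence_below:
  assumes "is_algebra A F" "finite A" "congruence A F \<theta>" "\<theta> \<noteq> Id_on A"
  obtains \<delta> where "prime_quotient A F \<delta> \<theta>" "\<delta> \<noteq> \<theta>"
proof -
  let ?S = "{\<kappa>. congruence A F \<kappa> \<and> \<kappa> \<subset> \<theta>}"
  have "\<theta> \<subseteq> A \<times> A" "Id_on A \<subseteq> \<theta>"
    using assms(3) by (auto simp: congruence_def equiv_def refl_on_def)
  then have "finite ?S" "Id_on A \<in> ?S"
    using assms congruence_Id_on[OF assms(1)] finite_subset[of ?S "Pow (A \<times> A)"] by auto
  then obtain \<delta> where d: "\<delta> \<in> ?S" "\<And>\<kappa>. \<kappa> \<in> ?S \<Longrightarrow> \<delta> \<subseteq> \<kappa> \<Longrightarrow> \<delta> = \<kappa>"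
    using finite_has_maximal[of ?S] by (metis (no_types, lifting) empty_iff)
  show thesis
  proof (rule that)
    show "prime_quotient A F \<delta> \<theta>"
    proof
      show "\<kappa> = \<delta> \<or> \<kappa> = \<theta>" if "congruence A F \<kappa>" "\<delta> \<subseteq> \<kappa>" "\<kappa> \<subseteq> \<theta>" for \<kappa>
        using d(2)[of \<kappa>] that by blast
    qed (use assms d(1) in auto)
  qed (use d in auto)
qed

lemma strongly_connected_imp_solvable:
  assumes alg: "is_algebra A F" and fin: "finite A"
    and sc: "\<And>U n p. neighborhood A F U \<Longrightarrow> poly_op U (induced_ops A F U) n p \<Longrightarrow> idempotent U n p
      \<Longrightarrow> strongly_connected U (tr_edges U n p)"
  shows "solvable A F"
proof (rule ccontr)
  assume ns: "\<not> solvable A F"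
  obtain k where k: "derived A F (Suc k) = derived A F k" using derived_stabilizes[OF alg fin] .
  let ?\<theta> = "derived A F k"
  obtain \<delta> where "prime_quotient A F \<delta> ?\<theta>" and d: "\<delta> \<noteq> ?\<theta>"
    using maximal_congruence_below[OF alg fin derived_congruence[OF alg]] ns solvable_def by metis
  then interpret prime_quotient A F \<delta> ?\<theta> by simp
  obtain e u0 u1 where e: "pol1 A F e" "\<And>x. x \<in> A \<Longrightarrow> e (e x) = e x"
    and u: "u0 \<in> e ` A" "u1 \<in> e ` A" "(u0, u1) \<in> ?\<theta>" "(u0, u1) \<notin> \<delta>"
    and min: "\<And>f x y. pol1 A F f \<Longrightarrow> (x, y) \<in> ?\<theta> \<Longrightarrow> (f x, f y) \<notin> \<delta> \<Longrightarrow> card (e ` A) \<le> card (f ` A)"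
    by (rule minimal_idempotent[OF d]) (rule that, assumption+)
  have "polf A F (projs 1) (\<lambda>xs. e (xs ! 0))" by (rule polf_comp1[OF e(1)]) (auto intro: polf.base)
  then have nb: "neighborhood A F (e ` A)"
    unfolding neighborhood_def clo_iff_polf
    by (intro exI[of _ "\<lambda>xs. e (xs ! 0)"]) (use e(2) in auto)
  interpret minimal_set A F \<delta> ?\<theta> e u0 u1
  proof
    fix f a assume "polf2 A F f" "\<And>w z. w \<in> e ` A \<Longrightarrow> z \<in> e ` A \<Longrightarrow> f w z \<in> e ` A"
      "a \<in> e ` A" "\<And>w. w \<in> e ` A \<Longrightarrow> f w a = w" "\<And>z. z \<in> e ` A \<Longrightarrow> f a z = z"
      "\<And>w z. w \<in> e ` A \<Longrightarrow> z \<in> e ` A \<Longrightarrow> f w (f w z) = f w z"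
    from no_pseudo_meet_if_strongly_connected[OF sc[OF nb] this] show "e ` A = {a}" .
  qed (use e u min in \<open>blast+\<close>)
  \<comment> \<open>At the stable stage [\<theta>, \<theta>] is \<theta> itself, so its inclusion in
    \<delta> contradicts the choice of \<delta> strictly below \<theta>.\<close>
  have "commutator A F ?\<theta> ?\<theta> \<subseteq> \<delta>"
    using c\<delta> centralizes_\<theta>_\<delta> unfolding commutator_def by blast
  then show False using k d sub by simp
qed

theorem theorem3p2:
  fixes A :: "'a set" and F :: "'a ops"
  assumes "is_algebra A F" and "finite A" and "A \<noteq> {}"
  shows "solvable A F \<longleftrightarrow>
    (\<forall>U. neighborhood A F U \<longrightarrow>
      (\<forall>n p. poly_op U (induced_ops A F U) n p \<and> idempotent U n p
         \<longrightarrow> strongly_connected U (tr_edges U n p)))"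
proof
  assume s: "solvable A F"
  show "\<forall>U. neighborhood A F U \<longrightarrow>
      (\<forall>n p. poly_op U (induced_ops A F U) n p \<and> idempotent U n p
         \<longrightarrow> strongly_connected U (tr_edges U n p))"
  proof (intro allI impI, elim conjE)
    fix U n p
    assume "neighborhood A F U" and p: "poly_op U (induced_ops A F U) n p" and i: "idempotent U n p"
    then obtain e where e: "polf A F (projs 1) e" "U = (\<lambda>x. e [x]) ` A"
      by (auto simp: neighborhood_def clo_iff_polf)
    have "e [x] \<in> A" if "x \<in> A" for x by (rule polf_closed[OF e(1) assms(1)]) (use that in auto)
    then have "U \<subseteq> A" unfolding e(2) by blast
    then show "strongly_connected U (tr_edges U n p)"
      using solvable_imp_strongly_connected[OF assms(1,2) _ s _ i] p by (simp add: clo_iff_polf)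
  qed
qed (use strongly_connected_imp_solvable[OF assms(1,2)] in blast)

end
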